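(* Let $(\mathfrak X,d)$ be a separable and complete CC space. Let $\tau$ be a measure-preserving transformation of the probability space $(\Omega,\mathcal F,P)$ and let $\mathcal I_\tau$ be the $\sigma$-algebra of invariant events with respect to $\tau$. If $X$ is an integrable $\mathfrak X$-valued random element, then $[n^{-1},X\circ\tau^i]_{i=0}^{n-1}\to E(X|\mathcal I_\tau)$ a.s. as $n\to\infty$.
   Context: A convex combination space (CC space) is a metric space $(\mathfrak X,d)$ endowed with a convex combination operation, which to all $n\ge1$, all $\lambda_1,\dots,\lambda_n>0$ with $\sum_{i=1}^n\lambda_i=1$ and all $u_1,\dots,u_n\in\mathfrak X$ assigns an element $[\lambda_1,u_1;\dots;\lambda_n,u_n]=[\lambda_i,u_i]_{i=1}^n$ of $\mathfrak X$, with $[1,u]=u$, and such that: (CC.i) $[\lambda_i,u_i]_{i=1}^n=[\lambda_{\sigma(i)},u_{\sigma(i)}]_{i=1}^n$ for every permutation $\sigma$ of $\{1,\dots,n\}$; (CC.ii) $[\lambda_i,u_i]_{i=1}^{n+2}=\big[\lambda_1,u_1;\dots;\lambda_n,u_n;\lambda_{n+1}+\lambda_{n+2},\big[\tfrac{\lambda_{n+j}}{\lambda_{n+1}+\lambda_{n+2}},u_{n+j}\big]_{j=1}^2\big]$; (CC.iii) if $u,v\in\mathfrak X$ and $\lambda^{(k)}\to\lambda\in(0,1)$ then $[\lambda^{(k)},u;1-\lambda^{(k)},v]\to[\lambda,u;1-\lambda,v]$; (CC.iv) for $u_1,u_2,v_1,v_2\in\mathfrak X$ and $\lambda\in(0,1)$,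 $d([\lambda,u_1;1-\lambda,u_2],[\lambda,v_1;1-\lambda,v_2])\le\lambda d(u_1,v_1)+(1-\lambda)d(u_2,v_2)$; (CC.v) for each $u\in\mathfrak X$ the limit $Ku:=\lim_{n\to\infty}[n^{-1},u]_{i=1}^n$ exists in $\mathfrak X$; $K$ is called the convexification operator. Write $K(\mathfrak X)=\{Ku:u\in\mathfrak X\}$; $K$ is idempotent. For points of $K(\mathfrak X)$, weights in $[0,1]$ are allowed by discarding entries with weight $0$. $(\Omega,\mathcal F,P)$ is a complete probability space without atoms. An $\mathcal F$-measurable $\tau:\Omega\to\Omega$ is measure-preserving if $P(\tau^{-1}(A))=P(A)$ for all $A\in\mathcal F$; $\mathcal I_\tau=\{A\in\mathcal F:\tau^{-1}(A)=A\}$. A random element is a map $X:\Omega\to\mathfrak X$ measurable with respect to $\mathcal F$ and the Borel $\sigma$-algebra; it is integrable if $d(u,X)$ is integrable for some (equivalently every) $u\in\mathfrak X$. Convex combinations of random elements are taken pointwise. A simple random element takes finitely many values; if $X=x_i$ on $\Omega_i$, where $\Omega_1,\dots,\Omega_n$ is a measurable partition of $\Omega$, write $X=[I_{\Omega_i},x_i]_{i=1}^n$ and define, for a sub-$\sigma$-algebra $\mathcal G\subset\mathcal F$, $E(X|\mathcal G)=[E(I_{\Omega_i}|\mathcal G),Kx_i]_{i=1}^n$. For integrable $X$: fix $u_0\in K(\mathfrak X)$ and a countable dense set $\{u_j:j\ge1\}\subset\mathfrak X$, let $\psi_n(x)=u_{m_n(x)}$, where $m_n(x)$ is the smallest $i\in\{0,\dots,n\}$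 with $d(u_i,x)=\min_{0\le j\le n}d(u_j,x)$, and define the conditional expectation $E(X|\mathcal G)=\lim_{n\to\infty}E(\psi_n(X)|\mathcal G)$ a.s. (up to a null set); the limit exists and is an integrable, $\mathcal G$-measurable, $K(\mathfrak X)$-valued random element. *)

theory Defs
  imports "HOL-Probability.Probability" "HOL-Combinatorics.Permutations"
begin

section \<open>Convex combination spaces\<close>

text \<open>
  The combination \<open>[\<lambda>\<^sub>1,u\<^sub>1;\<dots>;\<lambda>\<^sub>n,u\<^sub>n]\<close> is \<open>cc [(\<lambda>\<^sub>1,u\<^sub>1),\<dots>,(\<lambda>\<^sub>n,u\<^sub>n)]\<close>. The function \<open>cc\<close> is total, but
  it is constrained, and meaningful, only on lists satisfying \<open>is_weighting\<close>.
\<close>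

definition is_weighting :: "(real \<times> 'a) list \<Rightarrow> bool" where
  "is_weighting xs \<longleftrightarrow> xs \<noteq> [] \<and> (\<forall>p\<in>set xs. 0 < fst p) \<and> sum_list (map fst xs) = 1"

locale cc_space =
  fixes cc :: "(real \<times> 'a::metric_space) list \<Rightarrow> 'a"
  assumes cc_single: "cc [(1, u)] = u"
    and cc_permute: "is_weighting xs \<Longrightarrow> \<sigma> permutes {..<length xs} \<Longrightarrow> cc (permute_list \<sigma> xs) = cc xs"
    and cc_assoc: "is_weighting (xs @ [(a, u), (b, v)]) \<Longrightarrow>
          cc (xs @ [(a, u), (b, v)]) = cc (xs @ [(a + b, cc [(a / (a + b), u), (b / (a + b), v)])])"
    and cc_continuous: "0 < l \<Longrightarrow> l < 1 \<Longrightarrow> (\<And>k. 0 < ls k \<and> ls k < 1) \<Longrightarrow> ls \<longlonglongrightarrow> l \<Longrightarrow>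
          (\<lambda>k::nat. cc [(ls k, u), (1 - ls k, v)]) \<longlonglongrightarrow> cc [(l, u), (1 - l, v)]"
    and cc_dist: "0 < l \<Longrightarrow> l < 1 \<Longrightarrow>
          dist (cc [(l, u1), (1 - l, u2)]) (cc [(l, v1), (1 - l, v2)])
            \<le> l * dist u1 v1 + (1 - l) * dist u2 v2"
    and cc_convergent: "convergent (\<lambda>n. cc (replicate n (1 / real n, u)))"

definition convexification :: "((real \<times> 'a::metric_space) list \<Rightarrow> 'a) \<Rightarrow> 'a \<Rightarrow> 'a" where
  "convexification cc u = lim (\<lambda>n. cc (replicate n (1 / real n, u)))"

definition cc0 :: "((real \<times> 'a) list \<Rightarrow> 'a) \<Rightarrow> (real \<times> 'a) list \<Rightarrow> 'a" where
  "cc0 cc xs = cc (filter (\<lambda>p. fst p \<noteq> 0) xs)"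

section \<open>Measure-theoretic notions\<close>

definition atomless :: "'w measure \<Rightarrow> bool" where
  "atomless M \<longleftrightarrow>
    (\<forall>A\<in>sets M. 0 < measure M A \<longrightarrow> (\<exists>B\<in>sets M. B \<subseteq> A \<and> 0 < measure M B \<and> measure M B < measure M A))"

definition measure_preserving :: "'w measure \<Rightarrow> ('w \<Rightarrow> 'w) \<Rightarrow> bool" where
  "measure_preserving M \<tau> \<longleftrightarrow>
    \<tau> \<in> measurable M M \<and> (\<forall>A\<in>sets M. measure M (\<tau> -` A \<inter> space M) = measure M A)"

definition invariant_algebra :: "'w measure \<Rightarrow> ('w \<Rightarrow> 'w) \<Rightarrow> 'w measure" where
  "invariant_algebra M \<tau> = sigma (space M) {A \<in> sets M. \<tau> -` A \<inter> space M = A}"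

lemma space_invariant_algebra [simp]: "space (invariant_algebra M \<tau>) = space M"
  by (auto simp: invariant_algebra_def space_measure_of_conv)

lemma sets_invariant_algebra:
  assumes "\<tau> \<in> measurable M M"
  shows "sets (invariant_algebra M \<tau>) = {A \<in> sets M. \<tau> -` A \<inter> space M = A}"
proof -
  have "sigma_algebra (space M) {A \<in> sets M. \<tau> -` A \<inter> space M = A}"
    unfolding sigma_algebra_iff2
  proof (intro conjI ballI allI impI)
    show "{A \<in> sets M. \<tau> -` A \<inter> space M = A} \<subseteq> Pow (space M)"
      using sets.sets_into_space by auto
    show "{} \<in> {A \<in> sets M. \<tau> -` A \<inter> space M = A}" by simp
  next
    fix A assume "A \<in> {A \<in> sets M. \<tau> -` A \<inter> space M = A}"
    then show "space M - A \<in> {A \<in> sets M. \<tau> -` A \<inter> space M = A}"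
      using measurable_space[OF assms] by auto
  next
    fix A :: "nat \<Rightarrow> _" assume "range A \<subseteq> {A \<in> sets M. \<tau> -` A \<inter> space M = A}"
    then have "A i \<in> sets M" "\<tau> -` A i \<inter> space M = A i" for i by auto
    then show "\<Union> (range A) \<in> {A \<in> sets M. \<tau> -` A \<inter> space M = A}"
      by blast
  qed
  then show ?thesis
    unfolding invariant_algebra_def by (simp add: sigma_algebra.sets_measure_of_eq)
qed

section \<open>Random elements and conditional expectation\<close>

definition integrable_element :: "'w measure \<Rightarrow> ('w \<Rightarrow> 'a::metric_space) \<Rightarrow> bool" where
  "integrable_element M X \<longleftrightarrow>
    X \<in> borel_measurable M \<and> (\<exists>u. integrable M (\<lambda>\<omega>. dist u (X \<omega>)))"

text \<open>
  A simple element is written over the partition into its level sets; the order in which its values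
  are enumerated is immaterial by the symmetry axiom. The weights are nonnegative with sum 1 only
  almost surely, so the result is meaningful up to a null set.
\<close>

definition simple_cond_exp ::
    "((real \<times> 'a::metric_space) list \<Rightarrow> 'a) \<Rightarrow> 'w measure \<Rightarrow> 'w measure \<Rightarrow> ('w \<Rightarrow> 'a) \<Rightarrow> 'w \<Rightarrow> 'a" where
  "simple_cond_exp cc M G X \<omega> =
    cc0 cc (map (\<lambda>x. (real_cond_exp M G (indicator (X -` {x} \<inter> space M)) \<omega>, convexification cc x))
      (SOME xs. distinct xs \<and> set xs = X ` space M))"

definition nearest_index :: "(nat \<Rightarrow> 'a::metric_space) \<Rightarrow> nat \<Rightarrow> 'a \<Rightarrow> nat" where
  "nearest_index u n x = (LEAST i. i \<le> n \<and> dist (u i) x = Min ((\<lambda>j. dist (u j) x) ` {..n}))"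

definition nearest_point :: "(nat \<Rightarrow> 'a::metric_space) \<Rightarrow> nat \<Rightarrow> 'a \<Rightarrow> 'a" where
  "nearest_point u n x = u (nearest_index u n x)"

definition approximating_sequence ::
    "((real \<times> 'a::metric_space) list \<Rightarrow> 'a) \<Rightarrow> (nat \<Rightarrow> 'a) \<Rightarrow> bool" where
  "approximating_sequence cc u \<longleftrightarrow> u 0 \<in> range (convexification cc) \<and> closure (u ` {1..}) = UNIV"

text \<open>
  One version of the conditional expectation along the approximating sequence \<open>u\<close>; like
  \<open>simple_cond_exp\<close> it is determined up to a null set.
\<close>

definition cc_cond_exp ::
    "((real \<times> 'a::metric_space) list \<Rightarrow> 'a) \<Rightarrow> (nat \<Rightarrow> 'a) \<Rightarrow> 'w measure \<Rightarrow> 'w measure \<Rightarrow>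
      ('w \<Rightarrow> 'a) \<Rightarrow> 'w \<Rightarrow> 'a" where
  "cc_cond_exp cc u M G X \<omega> =
    lim (\<lambda>n. simple_cond_exp cc M G (\<lambda>\<omega>'. nearest_point u n (X \<omega>')) \<omega>)"

end

theory Submission
  imports Defs
begin

text \<open>
  A simple element \<open>Y\<close> visits its value \<open>v\<close> a number \<open>c n v\<close> of times before time \<open>n\<close>, so its mean is the
  combination of the points \<open>[1/c, v]\<close> (\<open>c = c n v\<close> copies) with weights \<open>c n v / n\<close>. The points tend to
  \<open>K v\<close> and the weights, by Birkhoff's theorem, to \<open>E(I(Y = v) | \<I>)\<close>; combinations of points of
  \<open>K\<close> depend continuously on the weights, up to and including weight \<open>0\<close>, because points of \<open>K\<close> may be
  split. For general \<open>X\<close>, the means of \<open>X\<close> and of its nearest-point approximation \<open>X\<^sub>m\<close> are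
  asymptotically within \<open>E(d(X, X\<^sub>m) | \<I>)\<close>, again by Birkhoff's theorem, and this tends to \<open>0\<close>. Hence
  the means of \<open>X\<close> are Cauchy, and their limit is that of \<open>E(X\<^sub>m | \<I>)\<close>, which in particular exists.
\<close>

section \<open>Convex combinations of lists\<close>

text \<open>Flattening a nested combination replaces an entry \<open>(s, cc xs)\<close> by the block
  \<open>scale_weights s xs\<close>.\<close>

definition scale_weights :: "real \<Rightarrow> (real \<times> 'a) list \<Rightarrow> (real \<times> 'a) list" where
  "scale_weights s xs = map (\<lambda>p. (s * fst p, snd p)) xs"

lemma scale_weights_append [simp]:
  "scale_weights s (xs @ ys) = scale_weights s xs @ scale_weights s ys"
  by (simp add: scale_weights_def)

lemma scale_weights_Nil [simp]: "scale_weights s [] = []"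
  by (simp add: scale_weights_def)

lemma scale_weights_Cons [simp]: "scale_weights s ((a, x) # xs) = (s * a, x) # scale_weights s xs"
  by (simp add: scale_weights_def)

lemma scale_weights_scale_weights [simp]:
  "scale_weights s (scale_weights t xs) = scale_weights (s * t) xs"
  by (simp add: scale_weights_def mult.assoc)

lemma scale_weights_1 [simp]: "scale_weights 1 xs = xs"
  by (simp add: scale_weights_def)

lemma scale_weights_map [simp]:
  "scale_weights s (map (\<lambda>i. (w i, f i)) js) = map (\<lambda>i. (s * w i, f i)) js"
  by (simp add: scale_weights_def)

lemma sum_list_scale_weights [simp]:
  "sum_list (map fst (scale_weights s xs)) = s * sum_list (map fst xs)"
  by (induction xs) (auto simp: scale_weights_def algebra_simps)

lemma scale_weights_eq_Nil_iff [simp]: "scale_weights s xs = [] \<longleftrightarrow> xs = []"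
  by (simp add: scale_weights_def)

lemma weights_sum_pos:
  fixes xs :: "(real \<times> 'a) list"
  assumes "\<forall>p\<in>set xs. 0 < fst p" "xs \<noteq> []"
  shows "sum_list (map fst xs) > 0"
  using assms
proof (induction xs)
  case (Cons a xs)
  then show ?case by (cases "xs = []") (auto intro: add_pos_pos)
qed simp

lemma is_weighting_scale:
  assumes "\<forall>p\<in>set xs. 0 < fst p" "xs \<noteq> []" "s = 1 / sum_list (map fst xs)"
  shows "is_weighting (scale_weights s xs)"
proof -
  have "sum_list (map fst (scale_weights s xs)) = 1" "s > 0"
    using weights_sum_pos[OF assms(1,2)] assms(3) by simp_all
  then show ?thesis using assms(1,2) by (auto simp: is_weighting_def scale_weights_def)
qed

lemma is_weighting_mset: "mset xs = mset ys \<Longrightarrow> is_weighting xs \<longleftrightarrow> is_weighting ys"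
  unfolding is_weighting_def
  by (metis mset_zero_iff mset_map set_mset_mset sum_mset_sum_list)

lemma is_weighting_map:
  "is_weighting (map (\<lambda>i. (w i, f i)) js) \<longleftrightarrow>
     js \<noteq> [] \<and> (\<forall>i\<in>set js. 0 < w i) \<and> sum_list (map w js) = 1"
  by (auto simp: is_weighting_def o_def)

context cc_space
begin

abbreviation "K \<equiv> convexification cc"

lemma cc_mset:
  assumes "is_weighting xs" "mset xs = mset ys"
  shows "cc xs = cc ys"
proof -
  obtain \<sigma> where "\<sigma> permutes {..<length xs}" "permute_list \<sigma> xs = ys"
    using mset_eq_permutation[OF assms(2)[symmetric]] assms(2)
    by metis
  then show ?thesis using cc_permute[OF assms(1)] by auto
qed

text \<open>Extends (CC.ii) to inner combinations of any length. The axiom merges the last two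
  points of \<open>xs\<close>, and it does so in the same way in the scaled list, because the
  quotients \<open>a / (a + b)\<close> do not see the factor \<open>s\<close>; induction on the
  length does the rest.\<close>

lemma cc_scale_append:
  assumes "is_weighting xs" "s > 0" "is_weighting (zs @ scale_weights s xs)"
  shows "cc (zs @ scale_weights s xs) = cc (zs @ [(s, cc xs)])"
  using assms
proof (induction "length xs" arbitrary: xs rule: less_induct)
  case less
  consider "xs = []" | u w where "xs = [(w, u)]"
    | ys a u b v where "xs = ys @ [(a, u), (b, v)]"
    by (metis append.left_neutral append_Cons append_assoc rev_exhaust surj_pair)
  then show ?case
  proof cases
    case 1
    with less.prems show ?thesis by (simp add: is_weighting_def)
  next
    case (2 u w)
    with less.prems have "w = 1" by (simp add: is_weighting_def)
    with 2 show ?thesis by (simp add: cc_single)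
  next
    case (3 ys a u b v)
    let ?c = "cc [(a / (a + b), u), (b / (a + b), v)]"
    let ?xs = "ys @ [(a + b, ?c)]"
    have ab: "a > 0" "b > 0" using less.prems(1) 3 by (auto simp: is_weighting_def)
    have quot: "s * a / (s * a + s * b) = a / (a + b)" "s * b / (s * a + s * b) = b / (a + b)"
      using \<open>s > 0\<close> by (simp_all flip: distrib_left)
    have "cc (zs @ scale_weights s xs) = cc ((zs @ scale_weights s ys) @ [(s * a, u), (s * b, v)])"
      using 3 by simp
    also have "\<dots> = cc ((zs @ scale_weights s ys) @ [(s * a + s * b, ?c)])"
      using cc_assoc[of "zs @ scale_weights s ys" "s * a" u "s * b" v] less.prems(3) 3
      by (simp add: quot)
    also have "\<dots> = cc (zs @ scale_weights s ?xs)"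
      by (simp add: algebra_simps)
    also have "\<dots> = cc (zs @ [(s, cc ?xs)])"
    proof (rule less.hyps)
      show "length ?xs < length xs" using 3 by simp
      show "is_weighting ?xs" using less.prems(1) ab 3 by (auto simp: is_weighting_def add.assoc)
      show "is_weighting (zs @ scale_weights s ?xs)"
        using less.prems(3) ab \<open>s > 0\<close> 3 by (auto simp: is_weighting_def distrib_left add.assoc intro!: add_pos_pos)
    qed (fact \<open>s > 0\<close>)
    also have "cc ?xs = cc xs" using cc_assoc less.prems(1) 3 by metis
    finally show ?thesis .
  qed
qed

text \<open>\<open>cc_scale_append\<close> collapses only a block at the end of a list, so the first
  block is brought there by symmetry once the second one is collapsed.\<close>

lemma cc_mix:
  assumes "is_weighting xs" "is_weighting ys" "0 < t" "t < 1"
  shows "cc (scale_weights t xs @ scale_weights (1 - t) ys) = cc [(t, cc xs), (1 - t, cc ys)]"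
proof -
  have w: "is_weighting (scale_weights t xs @ scale_weights (1 - t) ys)"
    using assms by (auto simp: is_weighting_def scale_weights_def o_def simp flip: sum_list_const_mult)
       (simp add: sum_list_const_mult)
  have w': "is_weighting ([(1 - t, cc ys)] @ scale_weights t xs)"
    using assms by (auto simp: is_weighting_def) (auto simp: scale_weights_def)
  have w'': "is_weighting [(1 - t, cc ys), (t, cc xs)]"
    using assms by (auto simp: is_weighting_def)
  have "cc (scale_weights t xs @ scale_weights (1 - t) ys) = cc (scale_weights t xs @ [(1 - t, cc ys)])"
    using assms w by (intro cc_scale_append) auto
  also have "\<dots> = cc ([(1 - t, cc ys)] @ scale_weights t xs)"
    by (rule sym, rule cc_mset[OF w']) simp
  also have "\<dots> = cc [(1 - t, cc ys), (t, cc xs)]"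
    using assms w' cc_scale_append[of xs t "[(1 - t, cc ys)]"] by simp
  also have "\<dots> = cc [(t, cc xs), (1 - t, cc ys)]"
    by (rule cc_mset[OF w'']) simp
  finally show ?thesis .
qed

lemma is_weighting_concat:
  assumes "\<And>j. j \<in> set js \<Longrightarrow> is_weighting (ys j)" "\<And>j. j \<in> set js \<Longrightarrow> 0 < w j"
    and "is_weighting (zs @ map (\<lambda>j. (w j, f j)) js)"
  shows "is_weighting (zs @ concat (map (\<lambda>j. scale_weights (w j) (ys j)) js))"
proof -
  have "sum_list (map fst (concat (map (\<lambda>j. scale_weights (w j) (ys j)) js))) = sum_list (map w js)"
    using assms(1) by (induction js) (auto simp: is_weighting_def)
  moreover have "p \<in> set (concat (map (\<lambda>j. scale_weights (w j) (ys j)) js)) \<Longrightarrow> 0 < fst p" for p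
    using assms(1,2) by (fastforce simp: is_weighting_def scale_weights_def)
  moreover have "concat (map (\<lambda>j. scale_weights (w j) (ys j)) js) = [] \<longleftrightarrow> js = []"
    using assms(1) by (cases js) (auto simp: is_weighting_def)
  ultimately show ?thesis
    using assms(3) unfolding is_weighting_def by (auto simp: o_def)
qed

text \<open>The prefix \<open>zs\<close> collects the blocks already collapsed: the block of
  \<open>j\<close> is moved to the end, collapsed by \<open>cc_scale_append\<close>, and its single
  entry joins \<open>zs\<close> for the induction.\<close>

lemma cc_concat:
  assumes "\<And>j. j \<in> set js \<Longrightarrow> is_weighting (ys j)" "\<And>j. j \<in> set js \<Longrightarrow> 0 < w j"
    and "is_weighting (zs @ map (\<lambda>j. (w j, cc (ys j))) js)"
  shows "cc (zs @ concat (map (\<lambda>j. scale_weights (w j) (ys j)) js)) =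
    cc (zs @ map (\<lambda>j. (w j, cc (ys j))) js)"
  using assms
proof (induction js arbitrary: zs)
  case (Cons j js)
  let ?c = "concat (map (\<lambda>j. scale_weights (w j) (ys j)) js)"
  have w: "is_weighting (zs @ concat (map (\<lambda>j. scale_weights (w j) (ys j)) (j # js)))"
    by (rule is_weighting_concat[OF Cons.prems])
  have w1: "is_weighting ((zs @ ?c) @ scale_weights (w j) (ys j))"
    using w by (subst is_weighting_mset[of _ "zs @ concat (map (\<lambda>j. scale_weights (w j) (ys j)) (j # js))"]) auto
  have w2: "is_weighting ((zs @ [(w j, cc (ys j))]) @ ?c)"
    by (rule is_weighting_concat[where f = "\<lambda>j. cc (ys j)"]) (use Cons.prems in auto)
  have "cc (zs @ concat (map (\<lambda>j. scale_weights (w j) (ys j)) (j # js))) =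
      cc ((zs @ ?c) @ scale_weights (w j) (ys j))"
    by (rule cc_mset[OF w]) simp
  also have "\<dots> = cc ((zs @ ?c) @ [(w j, cc (ys j))])"
    by (rule cc_scale_append) (use w1 Cons.prems in auto)
  also have "\<dots> = cc ((zs @ [(w j, cc (ys j))]) @ ?c)"
    by (rule sym, rule cc_mset[OF w2]) simp
  also have "\<dots> = cc ((zs @ [(w j, cc (ys j))]) @ map (\<lambda>j. (w j, cc (ys j))) js)"
    by (rule Cons.IH) (use Cons.prems in auto)
  finally show ?case by simp
qed simp

text \<open>Reduces a combination to a binary one, so that facts about two points, such as (CC.iv),
  extend to lists by induction. The tail has total weight \<open>1 - a\<close> and is
  renormalised.\<close>

lemma cc_Cons:
  assumes "is_weighting ((a, x) # xs)" "xs \<noteq> []"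
  shows "0 < a" "a < 1" "is_weighting (scale_weights (1 / (1 - a)) xs)"
    "cc ((a, x) # xs) = cc [(a, x), (1 - a, cc (scale_weights (1 / (1 - a)) xs))]"
proof -
  have s: "sum_list (map fst xs) = 1 - a" using assms by (simp add: is_weighting_def)
  show "0 < a" using assms by (simp add: is_weighting_def)
  show *: "a < 1" using weights_sum_pos[of xs] assms s by (simp add: is_weighting_def)
  show w: "is_weighting (scale_weights (1 / (1 - a)) xs)"
    using assms s by (intro is_weighting_scale) (auto simp: is_weighting_def)
  show "cc ((a, x) # xs) = cc [(a, x), (1 - a, cc (scale_weights (1 / (1 - a)) xs))]"
    using cc_scale_append[OF w, of "1 - a" "[(a, x)]"] * assms by simp
qed

text \<open>(CC.iv) is applied to the head and the renormalised tail; its factor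
  \<open>1 - w j\<close> cancels the renormalisation, which is why \<open>w\<close> varies in the
  induction.\<close>

lemma dist_cc_le:
  assumes "js \<noteq> []" "\<And>j. j \<in> set js \<Longrightarrow> 0 < w j" "sum_list (map w js) = 1"
  shows "dist (cc (map (\<lambda>j. (w j, f j)) js)) (cc (map (\<lambda>j. (w j, g j)) js))
    \<le> (\<Sum>j\<leftarrow>js. w j * dist (f j) (g j))"
  using assms
proof (induction js arbitrary: w)
  case (Cons j js)
  show ?case
  proof (cases "js = []")
    case True
    with Cons.prems show ?thesis by (simp add: cc_single)
  next
    case False
    have w: "is_weighting ((w j, h j) # map (\<lambda>j. (w j, h j)) js)" for h :: "_ \<Rightarrow> 'a"
      using is_weighting_map[of w h "j # js"] Cons.prems by auto
    note f = cc_Cons[OF w[of f]] and g = cc_Cons[OF w[of g]]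
    have wj: "0 < w j" "w j < 1" using f(1,2) False by auto
    let ?w = "\<lambda>i. 1 / (1 - w j) * w i"
    let ?f = "cc (map (\<lambda>i. (?w i, f i)) js)" and ?g = "cc (map (\<lambda>i. (?w i, g i)) js)"
    have "dist (cc (map (\<lambda>j. (w j, f j)) (j # js))) (cc (map (\<lambda>j. (w j, g j)) (j # js)))
        = dist (cc [(w j, f j), (1 - w j, ?f)]) (cc [(w j, g j), (1 - w j, ?g)])"
      using f(4) g(4) False by simp
    also have "\<dots> \<le> w j * dist (f j) (g j) + (1 - w j) * dist ?f ?g"
      by (rule cc_dist) (use wj in auto)
    also have "dist ?f ?g \<le> (\<Sum>i\<leftarrow>js. ?w i * dist (f i) (g i))"
    proof (rule Cons.IH)
      show "sum_list (map ?w js) = 1"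
        using Cons.prems(3) wj by (simp only: sum_list_const_mult) (simp add: field_simps)
      show "0 < ?w i" if "i \<in> set js" for i using that wj Cons.prems by simp
    qed (fact False)
    also have "(\<Sum>i\<leftarrow>js. ?w i * dist (f i) (g i)) = 1 / (1 - w j) * (\<Sum>i\<leftarrow>js. w i * dist (f i) (g i))"
      by (simp only: sum_list_const_mult mult.assoc)
    finally show ?thesis using wj by (simp add: mult_left_mono)
  qed
qed simp

lemma tendsto_cc_pair:
  assumes "0 < t" "t < 1" "(f \<longlongrightarrow> x) F" "(g \<longlongrightarrow> y) F"
  shows "((\<lambda>n. cc [(t, f n), (1 - t, g n)]) \<longlongrightarrow> cc [(t, x), (1 - t, y)]) F"
proof -
  have "((\<lambda>n. dist (cc [(t, f n), (1 - t, g n)]) (cc [(t, x), (1 - t, y)])) \<longlongrightarrow> 0) F"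
  proof (rule Lim_null_comparison)
    show "\<forall>\<^sub>F n in F. norm (dist (cc [(t, f n), (1 - t, g n)]) (cc [(t, x), (1 - t, y)]))
       \<le> t * dist (f n) x + (1 - t) * dist (g n) y"
      using cc_dist[OF assms(1,2)] by simp
    have "((\<lambda>n. t * dist (f n) x + (1 - t) * dist (g n) y) \<longlongrightarrow> t * dist x x + (1 - t) * dist y y) F"
      by (intro tendsto_intros assms)
    then show "((\<lambda>n. t * dist (f n) x + (1 - t) * dist (g n) y) \<longlongrightarrow> 0) F" by simp
  qed
  then show ?thesis by (rule iffD2[OF tendsto_dist_iff])
qed

section \<open>Points of the range of \<open>K\<close> may be split\<close>

lemma tendsto_convexification: "(\<lambda>n. cc (replicate n (1 / real n, x))) \<longlonglongrightarrow> K x"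
  unfolding convexification_def using cc_convergent convergent_LIMSEQ_iff by blast

lemma is_weighting_replicate: "n > 0 \<Longrightarrow> is_weighting (replicate n (1 / real n, x))"
  by (simp add: is_weighting_def sum_list_replicate)

text \<open>The uniform average of \<open>q * N\<close> copies of \<open>x\<close> is the mixture,
  with weight \<open>p / q\<close>, of those of \<open>p * N\<close> and \<open>(q - p) * N\<close>
  copies. All three tend to \<open>K x\<close> as \<open>N\<close> grows, and
  \<open>tendsto_cc_pair\<close> passes to the limit.\<close>

lemma cc_convexification_ratio:
  assumes "0 < p" "p < q" "t = real p / real q"
  shows "cc [(t, K x), (1 - t, K x)] = K x"
proof -
  let ?a = "\<lambda>n. cc (replicate n (1 / real n, x))"
  have t: "0 < t" "t < 1" "1 - t = real (q - p) / real q"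
    using assms by (simp_all add: diff_divide_distrib)
  have eq: "cc [(t, ?a (p * Suc n)), (1 - t, ?a ((q - p) * Suc n))] = ?a (q * Suc n)" for n
  proof -
    have "replicate (q * Suc n) (1 / real (q * Suc n), x) =
        scale_weights t (replicate (p * Suc n) (1 / real (p * Suc n), x)) @
        scale_weights (1 - t) (replicate ((q - p) * Suc n) (1 / real ((q - p) * Suc n), x))"
    proof -
      have cancel: "a / real q * (1 / (a * N)) = 1 / (real q * N)" if "a \<noteq> 0" for a N :: real
        using that by simp
      have "t * (1 / real (p * Suc n)) = 1 / real (q * Suc n)"
        "(1 - t) * (1 / real ((q - p) * Suc n)) = 1 / real (q * Suc n)"
        unfolding t(3) of_nat_mult using cancel[of "real p"] cancel[of "real (q - p)"] assms by auto
      moreover have "q * Suc n = p * Suc n + (q - p) * Suc n"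
        using assms by (metis add_mult_distrib le_add_diff_inverse less_imp_le)
      ultimately show ?thesis
        by (simp only: scale_weights_def map_replicate fst_conv snd_conv replicate_add)
    qed
    then show ?thesis
      using cc_mix[OF is_weighting_replicate is_weighting_replicate t(1,2), of "p * Suc n" "(q - p) * Suc n" x x]
        assms(1,2) by (metis mult_pos_pos zero_less_Suc zero_less_diff)
  qed
  have sub: "(\<lambda>n. ?a (k * Suc n)) \<longlonglongrightarrow> K x" if "k > 0" for k
    using LIMSEQ_subseq_LIMSEQ[OF tendsto_convexification, of "\<lambda>n. k * Suc n"] that
    by (auto simp: strict_mono_def o_def)
  have "(\<lambda>n. cc [(t, ?a (p * Suc n)), (1 - t, ?a ((q - p) * Suc n))]) \<longlonglongrightarrow> cc [(t, K x), (1 - t, K x)]"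
    using assms by (intro tendsto_cc_pair t sub) auto
  moreover have "(\<lambda>n. cc [(t, ?a (p * Suc n)), (1 - t, ?a ((q - p) * Suc n))]) \<longlonglongrightarrow> K x"
    unfolding eq using assms by (intro sub) auto
  ultimately show ?thesis by (rule LIMSEQ_unique)
qed

text \<open>Rational weights are dense, and (CC.iii) gives continuity in the weight.\<close>

lemma cc_convexification_pair:
  assumes "0 < t" "t < 1"
  shows "cc [(t, K x), (1 - t, K x)] = K x"
proof -
  \<comment> \<open>The width \<open>(1 - t) / real (Suc k)\<close> tends to \<open>0\<close> and
    keeps every \<open>r k\<close> below \<open>1\<close>, as \<open>cc_continuous\<close> asks of
    all terms of the sequence and not only of the late ones.\<close>
  have "\<exists>r\<in>\<rat>. t < r \<and> r < t + (1 - t) / real (Suc k)" for k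
    using assms by (intro Rats_dense_in_real) simp
  then obtain r where r: "\<And>k. r k \<in> \<rat>" "\<And>k. t < r k" "\<And>k. r k < t + (1 - t) / real (Suc k)"
    by metis
  have r01: "0 < r k" "r k < 1" for k
  proof -
    show "0 < r k" using r(2)[of k] assms by linarith
    have "(1 - t) / real (Suc k) \<le> (1 - t) / 1" using assms by (intro divide_left_mono) auto
    then show "r k < 1" using r(3)[of k] by simp
  qed
  have lim: "r \<longlonglongrightarrow> t"
  proof (rule tendsto_sandwich)
    show "\<forall>\<^sub>F k in sequentially. t \<le> r k" "\<forall>\<^sub>F k in sequentially. r k \<le> t + (1 - t) / real (Suc k)"
      using r by (auto intro!: always_eventually less_imp_le)
    show "(\<lambda>k. t + (1 - t) / real (Suc k)) \<longlonglongrightarrow> t"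
      using tendsto_add[OF tendsto_const LIMSEQ_Suc[OF lim_const_over_n]] by fastforce
  qed simp
  have "cc [(r k, K x), (1 - r k, K x)] = K x" for k
  proof -
    obtain p q :: nat where pq: "q \<noteq> 0" "\<bar>r k\<bar> = real p / real q"
      using Rats_abs_nat_div_natE[OF r(1)[of k]] by metis
    have rk: "r k = real p / real q" using pq r01[of k] by simp
    then have "0 < p" "p < q" using pq(1) r01[of k] by (auto intro: gr0I)
    from this rk show ?thesis by (rule cc_convexification_ratio)
  qed
  then have "(\<lambda>k. K x) \<longlonglongrightarrow> cc [(t, K x), (1 - t, K x)]"
    using cc_continuous[OF assms _ lim, of "K x" "K x"] r01 by auto
  then show ?thesis by (simp add: LIMSEQ_const_iff)
qed

lemma cc_convexification_const:
  assumes "is_weighting xs" "\<And>p. p \<in> set xs \<Longrightarrow> snd p = K x"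
  shows "cc xs = K x"
  using assms
proof (induction "length xs" arbitrary: xs rule: less_induct)
  case less
  then obtain a y ys where xs: "xs = (a, y) # ys" by (metis is_weighting_def neq_Nil_conv surj_pair)
  show ?case
  proof (cases "ys = []")
    case True
    then show ?thesis using less.prems xs by (auto simp: is_weighting_def cc_single)
  next
    case False
    note c = cc_Cons[OF less.prems(1)[unfolded xs] False]
    have "cc (scale_weights (1 / (1 - a)) ys) = K x"
      by (rule less.hyps) (use less.prems c xs in \<open>auto simp: scale_weights_def\<close>)
    moreover have "y = K x" using less.prems(2)[of "(a, y)"] xs by simp
    ultimately show ?thesis using c cc_convexification_pair[of a x] xs by simp
  qed
qed

end

section \<open>Convergence of empirical combinations\<close>

lemma sum_list_tendsto:
  fixes f :: "'b \<Rightarrow> 'c \<Rightarrow> real"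
  assumes "\<And>j. j \<in> set js \<Longrightarrow> (f j \<longlongrightarrow> l j) F"
  shows "((\<lambda>n. \<Sum>j\<leftarrow>js. f j n) \<longlongrightarrow> (\<Sum>j\<leftarrow>js. l j)) F"
  using assms by (induction js) (auto intro!: tendsto_add)

text \<open>Groups indices by value, up to order, as suits the symmetry axiom. The right-hand side
  keeps only indices with values in \<open>vs\<close>, since the shorter lists in the induction no
  longer exhaust the values.\<close>

lemma mset_concat_replicate_fibres:
  assumes "distinct vs"
  shows "mset (concat (map (\<lambda>v. replicate (length (filter (\<lambda>i. y i = v) js)) (g v)) vs)) =
    image_mset (\<lambda>i. g (y i)) (filter_mset (\<lambda>i. y i \<in> set vs) (mset js))"
  using assms
proof (induction vs)
  case (Cons v vs)
  have "replicate_mset (length (filter (\<lambda>i. y i = v) js)) (g v) +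
      image_mset (\<lambda>i. g (y i)) (filter_mset (\<lambda>i. y i \<in> set vs) (mset js)) =
    image_mset (\<lambda>i. g (y i)) (filter_mset (\<lambda>i. y i = v \<or> y i \<in> set vs) (mset js))"
    using Cons.prems by (induction js) auto
  with Cons show ?case by simp
qed simp

text \<open>Cesaro weighting: the indices with small \<open>c n\<close> contribute a bounded numerator, the others a
  small factor \<open>e (c n)\<close>; \<open>c\<close> itself need not tend to infinity.\<close>

lemma tendsto_weighted_0:
  fixes c :: "nat \<Rightarrow> nat" and e :: "nat \<Rightarrow> real"
  assumes "e \<longlonglongrightarrow> 0" "\<And>n. c n \<le> n" "\<And>n. 0 \<le> e n"
  shows "(\<lambda>n. real (c n) / real n * e (c n)) \<longlonglongrightarrow> 0"
proof (rule tendstoI)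
  fix \<epsilon> :: real assume \<epsilon>: "\<epsilon> > 0"
  then obtain N where N: "\<And>k. k \<ge> N \<Longrightarrow> e k < \<epsilon>"
    using order_tendstoD(2)[OF assms(1) \<epsilon>] by (auto simp: eventually_sequentially)
  define B where "B = (\<Sum>k<N. real k * e k)"
  have "\<forall>\<^sub>F n in sequentially. B / real n < \<epsilon>"
    using \<epsilon> by (intro order_tendstoD(2)[OF lim_const_over_n]) auto
  with eventually_gt_at_top[of 0]
  show "\<forall>\<^sub>F n in sequentially. dist (real (c n) / real n * e (c n)) 0 < \<epsilon>"
  proof eventually_elim
    case (elim n)
    have "real (c n) / real n * e (c n) < \<epsilon>"
    proof (cases "c n < N")
      case True
      then have "real (c n) * e (c n) \<le> B"
        unfolding B_def using assms(3) by (intro member_le_sum) auto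
      then have "real (c n) * e (c n) / real n \<le> B / real n" by (intro divide_right_mono) auto
      then show ?thesis using elim by simp
    next
      case False
      have "real (c n) / real n * e (c n) \<le> 1 * e (c n)"
        using assms(2)[of n] assms(3) elim by (intro mult_right_mono) auto
      then show ?thesis using N[of "c n"] False by simp
    qed
    then show ?case using assms(3)[of "c n"] by (simp add: abs_mult)
  qed
qed

context cc_space
begin

section \<open>Continuity in the weights, with weight zero allowed\<close>

lemma cc0_map: "cc0 cc (map (\<lambda>j. (w j, f j)) js) = cc (map (\<lambda>j. (w j, f j)) (filter (\<lambda>j. w j \<noteq> 0) js))"
  by (simp add: cc0_def filter_map o_def)

lemma is_weighting_filter:
  assumes "\<And>j. j \<in> set js \<Longrightarrow> 0 \<le> w j" "(\<Sum>j\<leftarrow>js. w j) = (1::real)"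
  shows "is_weighting (map (\<lambda>j. (w j, f j)) (filter (\<lambda>j. w j \<noteq> 0) js))"
proof -
  have "sum_list (map w (filter (\<lambda>j. w j \<noteq> 0) js)) = 1"
    using assms(2) sum_list_map_filter[of js "\<lambda>j. w j \<noteq> 0" w] by simp
  moreover from this have "filter (\<lambda>j. w j \<noteq> 0) js \<noteq> []" by auto
  ultimately show ?thesis using assms(1) unfolding is_weighting_map by (auto simp: less_le)
qed

lemma dist_cc0_le:
  assumes "\<And>j. j \<in> set js \<Longrightarrow> 0 \<le> w j" "(\<Sum>j\<leftarrow>js. w j) = 1"
  shows "dist (cc0 cc (map (\<lambda>j. (w j, f j)) js)) (cc0 cc (map (\<lambda>j. (w j, g j)) js))
    \<le> (\<Sum>j\<leftarrow>js. w j * dist (f j) (g j))"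
proof -
  let ?js = "filter (\<lambda>j. w j \<noteq> 0) js"
  have "dist (cc (map (\<lambda>j. (w j, f j)) ?js)) (cc (map (\<lambda>j. (w j, g j)) ?js))
      \<le> (\<Sum>j\<leftarrow>?js. w j * dist (f j) (g j))"
    by (rule dist_cc_le) (use is_weighting_filter[OF assms] in \<open>auto simp: is_weighting_map\<close>)
  also have "\<dots> = (\<Sum>j\<leftarrow>js. w j * dist (f j) (g j))"
    by (rule sum_list_map_filter) auto
  finally show ?thesis by (simp add: cc0_map)
qed

text \<open>This fails for general points: it needs the values \<open>K x\<close> to be unchanged when an entry is
  split in two.\<close>

lemma cc0_convexification_affine:
  assumes t: "0 < t" "t < 1"
    and a: "\<And>j. j \<in> set js \<Longrightarrow> 0 \<le> a j" "(\<Sum>j\<leftarrow>js. a j) = 1"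
    and b: "\<And>j. j \<in> set js \<Longrightarrow> 0 \<le> b j" "(\<Sum>j\<leftarrow>js. b j) = 1"
  shows "cc0 cc (map (\<lambda>j. (t * a j + (1 - t) * b j, K (x j))) js) =
    cc [(t, cc0 cc (map (\<lambda>j. (a j, K (x j))) js)), (1 - t, cc0 cc (map (\<lambda>j. (b j, K (x j))) js))]"
proof -
  define w where "w j = t * a j + (1 - t) * b j" for j
  let ?nz = "filter (\<lambda>p. fst p \<noteq> (0::real))"
  let ?js = "filter (\<lambda>j. w j \<noteq> 0) js"
  \<comment> \<open>Splits the entry of \<open>j\<close> into the shares coming from
    \<open>a\<close> and from \<open>b\<close>, relative to \<open>w j\<close>. A zero share is
    filtered out, as \<open>cc\<close> is constrained only for positive weights; either way
    \<open>?ys j\<close> combines to \<open>K (x j)\<close>.\<close>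
  let ?ys = "\<lambda>j. ?nz [(t * a j / w j, K (x j)), ((1 - t) * b j / w j, K (x j))]"
  have w0: "0 \<le> w j" if "j \<in> set js" for j using t a b that by (simp add: w_def)
  have w1: "(\<Sum>j\<leftarrow>js. w j) = 1"
    using a(2) b(2) by (simp add: w_def sum_list_addf sum_list_const_mult)
  have ys: "is_weighting (?ys j)" if "j \<in> set ?js" for j
  proof -
    have "w j > 0" using that w0[of j] by auto
    moreover have "0 \<le> a j" "0 \<le> b j" using that a b by auto
    moreover have "t * a j / w j + (1 - t) * b j / w j = 1"
      using \<open>w j > 0\<close> by (simp add: w_def flip: add_divide_distrib)
    ultimately show ?thesis using t by (auto simp: is_weighting_def)
  qed
  then have cys: "cc (?ys j) = K (x j)" if "j \<in> set ?js" for j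
    using that by (intro cc_convexification_const) (auto split: if_splits)
  have w: "is_weighting (map (\<lambda>j. (w j, K (x j))) ?js)" by (rule is_weighting_filter[OF w0 w1])
  have weq: "map (\<lambda>j. (w j, K (x j))) ?js = map (\<lambda>j. (w j, cc (?ys j))) ?js"
    using cys by (intro map_cong) auto
  let ?c = "concat (map (\<lambda>j. scale_weights (w j) (?ys j)) ?js)"
  let ?A = "\<lambda>a. map (\<lambda>j. (a j, K (x j))) (filter (\<lambda>j. a j \<noteq> 0) js)"
  have wc: "is_weighting ?c"
    using is_weighting_concat[of ?js ?ys w "[]" "\<lambda>j. cc (?ys j)"] ys w w0 unfolding weq
    by (auto simp: less_le)
  \<comment> \<open>Flattening interleaves the two families of entries. Dropping the indices with
    \<open>w j = 0\<close> loses nothing, since both \<open>a j\<close> and \<open>b j\<close>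
    vanish there.\<close>
  have mset: "mset ?c = mset (scale_weights t (?A a) @ scale_weights (1 - t) (?A b))"
    using a(1) b(1) w0
  proof (induction js)
    case (Cons j js)
    have "w j = 0 \<longleftrightarrow> a j = 0 \<and> b j = 0"
    proof -
      have "0 \<le> a j" "0 \<le> b j" using Cons.prems by auto
      then show ?thesis using t by (auto simp: w_def add_nonneg_eq_0_iff)
    qed
    then show ?case using Cons t by auto
  qed simp
  have "cc0 cc (map (\<lambda>j. (w j, K (x j))) js) = cc ?c"
    unfolding cc0_map weq using cc_concat[of ?js ?ys w "[]"] ys w w0 weq by (auto simp: less_le)
  also have "\<dots> = cc (scale_weights t (?A a) @ scale_weights (1 - t) (?A b))"
    by (rule cc_mset[OF wc mset])
  also have "\<dots> = cc [(t, cc (?A a)), (1 - t, cc (?A b))]"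
    by (rule cc_mix[OF is_weighting_filter[OF a] is_weighting_filter[OF b] t])
  finally show ?thesis unfolding cc0_map w_def .
qed

text \<open>If \<open>q n \<ge> (1 - \<epsilon>) p\<close>, both \<open>q n\<close> and \<open>p\<close> are mixtures with weight \<open>1 - \<epsilon>\<close> on \<open>p\<close>, so the
  combinations differ by at most \<open>\<epsilon>\<close> times the diameter; entries with \<open>p j = 0\<close> are harmless.\<close>

lemma tendsto_cc0_convexification:
  assumes lim: "\<And>j. j \<in> set js \<Longrightarrow> ((\<lambda>n. q n j) \<longlongrightarrow> p j) F" and "F \<noteq> bot"
    and q: "\<forall>\<^sub>F n in F. (\<forall>j\<in>set js. 0 \<le> q n j) \<and> (\<Sum>j\<leftarrow>js. q n j) = 1"
  shows "((\<lambda>n. cc0 cc (map (\<lambda>j. (q n j, K (x j))) js)) \<longlongrightarrow> cc0 cc (map (\<lambda>j. (p j, K (x j))) js)) F"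
proof -
  let ?C = "\<lambda>w. cc0 cc (map (\<lambda>j. (w j, K (x j))) js)"
  have p0: "0 \<le> p j" if "j \<in> set js" for j
    by (rule tendsto_lowerbound[OF lim[OF that] _ \<open>F \<noteq> bot\<close>]) (rule eventually_mono[OF q], use that in auto)
  have p1: "(\<Sum>j\<leftarrow>js. p j) = 1"
  proof (rule tendsto_unique[OF \<open>F \<noteq> bot\<close> sum_list_tendsto[OF lim]])
    show "((\<lambda>n. \<Sum>j\<leftarrow>js. q n j) \<longlongrightarrow> 1) F"
      by (rule tendsto_eventually) (rule eventually_mono[OF q], auto)
  qed
  then obtain j0 where j0: "j0 \<in> set js" by (cases js) auto
  define D where "D = Max ((\<lambda>j. dist (K (x j)) (K (x j0))) ` set js)"
  \<comment> \<open>A bound uniform in the weights: \<open>K (x j0)\<close> is itself the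
    combination, with weights \<open>w\<close>, of copies of itself, so \<open>dist_cc0_le\<close>
    applies with a constant second family.\<close>
  have D: "dist (?C w) (K (x j0)) \<le> D"
    if w: "\<And>j. j \<in> set js \<Longrightarrow> 0 \<le> w j" "(\<Sum>j\<leftarrow>js. w j) = 1" for w
  proof -
    have "cc0 cc (map (\<lambda>j. (w j, K (x j0))) js) = K (x j0)"
      unfolding cc0_map by (rule cc_convexification_const[OF is_weighting_filter[OF w]]) auto
    then have "dist (?C w) (K (x j0)) \<le> (\<Sum>j\<leftarrow>js. w j * dist (K (x j)) (K (x j0)))"
      using dist_cc0_le[OF w, of "\<lambda>j. K (x j)" "\<lambda>_. K (x j0)"] by simp
    also have "\<dots> \<le> (\<Sum>j\<leftarrow>js. w j * D)"
      by (rule sum_list_mono) (auto simp: D_def intro!: mult_left_mono w)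
    also have "\<dots> = D" using w(2) by (simp add: sum_list_mult_const)
    finally show ?thesis .
  qed
  have "0 \<le> D" using D[OF p0 p1] zero_le_dist order_trans by blast
  show ?thesis
  proof (rule tendstoI)
    fix e :: real assume "e > 0"
    \<comment> \<open>The first bound keeps \<open>\<epsilon> < 1\<close>; the second gives
      \<open>\<epsilon> * (2 * D) < e\<close>, with \<open>2 * D + 1\<close> in the denominator in
      case \<open>D = 0\<close>.\<close>
    define \<epsilon> where "\<epsilon> = min (1 / 2) (e / (2 * (2 * D + 1)))"
    have \<epsilon>: "0 < \<epsilon>" "\<epsilon> < 1" using \<open>0 \<le> D\<close> \<open>e > 0\<close> by (auto simp: \<epsilon>_def)
    have "\<epsilon> * (2 * D) < e"
    proof -
      have "\<epsilon> * (2 * D) \<le> e / (2 * (2 * D + 1)) * (2 * D)"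
        using \<open>0 \<le> D\<close> by (intro mult_right_mono) (auto simp: \<epsilon>_def)
      also have "\<dots> < e" using \<open>0 \<le> D\<close> \<open>e > 0\<close> by (simp add: field_simps) (smt (verit) mult_nonneg_nonneg)
      finally show ?thesis .
    qed
    have "\<forall>\<^sub>F n in F. \<forall>j\<in>set js. (1 - \<epsilon>) * p j \<le> q n j"
    proof (intro eventually_ball_finite ballI)
      fix j assume j: "j \<in> set js"
      show "\<forall>\<^sub>F n in F. (1 - \<epsilon>) * p j \<le> q n j"
      \<comment> \<open>The limit \<open>p j\<close> exceeds \<open>(1 - \<epsilon>) * p j\<close>
        strictly only if \<open>p j > 0\<close>; otherwise the claim is just that
        \<open>q n j\<close> is nonnegative.\<close>
      proof (cases "p j = 0")
        case True
        from q show ?thesis by eventually_elim (use True j in auto)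
      next
        case False
        then have "(1 - \<epsilon>) * p j < p j" using p0[OF j] \<epsilon> by (simp add: less_le)
        from order_tendstoD(1)[OF lim[OF j] this] show ?thesis by eventually_elim simp
      qed
    qed simp
    with q show "\<forall>\<^sub>F n in F. dist (?C (q n)) (?C p) < e"
    proof eventually_elim
      case (elim n)
      \<comment> \<open>\<open>r\<close> solves
        \<open>q n = (1 - \<epsilon>) * p + \<epsilon> * r\<close>; the bound just obtained makes it
        nonnegative.\<close>
      define r where "r j = (q n j - (1 - \<epsilon>) * p j) / \<epsilon>" for j
      have r0: "0 \<le> r j" if "j \<in> set js" for j using elim that \<epsilon> by (auto simp: r_def)
      have r1: "(\<Sum>j\<leftarrow>js. r j) = 1"
        using elim p1 \<epsilon>
        by (simp add: r_def divide_inverse sum_list_mult_const sum_list_subtractf sum_list_const_mult)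
      have t: "0 < 1 - \<epsilon>" "1 - \<epsilon> < 1" using \<epsilon> by auto
      have qr: "q n = (\<lambda>j. (1 - \<epsilon>) * p j + (1 - (1 - \<epsilon>)) * r j)" using \<epsilon> by (auto simp: r_def)
      have pp: "p = (\<lambda>j. (1 - \<epsilon>) * p j + (1 - (1 - \<epsilon>)) * p j)" by (auto simp: algebra_simps)
      have "?C (q n) = cc [(1 - \<epsilon>, ?C p), (1 - (1 - \<epsilon>), ?C r)]"
        by (subst qr, rule cc0_convexification_affine[OF t p0 p1 r0 r1])
      moreover have "?C p = cc [(1 - \<epsilon>, ?C p), (1 - (1 - \<epsilon>), ?C p)]"
        by (subst pp, rule cc0_convexification_affine[OF t p0 p1 p0 p1])
      ultimately have "dist (?C (q n)) (?C p) \<le> \<epsilon> * dist (?C r) (?C p)"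
        using cc_dist[OF t, of "?C p" "?C r" "?C p" "?C p"] by simp
      also have "\<dots> \<le> \<epsilon> * (2 * D)"
        using D[OF r0 r1] D[OF p0 p1] dist_triangle2[of "?C r" "?C p" "K (x j0)"] \<epsilon>
        by (intro mult_left_mono) auto
      finally show ?case using \<open>\<epsilon> * (2 * D) < e\<close> by simp
    qed
  qed
qed

text \<open>The indices with value \<open>v\<close> contribute \<open>c v\<close> entries of weight
  \<open>1 / n\<close>, that is, the uniform average of \<open>c v\<close> copies of
  \<open>v\<close> taken with weight \<open>c v / n\<close>. Values not attained are discarded by
  \<open>cc0\<close>.\<close>

lemma cc_group_values:
  assumes "distinct vs" "\<And>i. i < n \<Longrightarrow> y i \<in> set vs" "n > 0"
  defines "c v \<equiv> card {i. i < n \<and> y i = v}"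
  shows "cc (map (\<lambda>i. (1 / real n, y i)) [0..<n]) =
    cc0 cc (map (\<lambda>v. (c v / n, cc (replicate (c v) (1 / c v, v)))) vs)"
    and "(\<Sum>v\<leftarrow>vs. c v / n) = 1"
proof -
  have c: "c v = length (filter (\<lambda>i. y i = v) [0..<n])" for v
    by (simp add: c_def length_filter_conv_card) (rule arg_cong[of _ _ card], auto)
  let ?ys = "\<lambda>v. replicate (c v) (1 / real (c v), v)"
  let ?vs = "filter (\<lambda>v. real (c v) / real n \<noteq> 0) vs"
  let ?l = "map (\<lambda>i. (1 / real n, y i)) [0..<n]"
  let ?C = "concat (map (\<lambda>v. scale_weights (c v / n) (?ys v)) ?vs)"
  \<comment> \<open>\<open>g\<close> is left arbitrary, also in its type: the constant
    \<open>1\<close> gives the sum of the counts, and \<open>v\<close> paired with the weight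
    \<open>1 / n\<close> gives the list itself.\<close>
  have m: "mset (concat (map (\<lambda>v. replicate (c v) (g v)) vs)) = mset (map (\<lambda>i. g (y i)) [0..<n])"
    for g :: "'a \<Rightarrow> 'b"
  proof -
    have "filter_mset (\<lambda>i. y i \<in> set vs) (mset [0..<n]) = mset [0..<n]"
      using assms(2) by (auto simp: filter_mset_eq_conv)
    then show ?thesis
      unfolding c mset_concat_replicate_fibres[OF assms(1)] by simp
  qed
  have "sum_mset (mset (concat (map (\<lambda>v. replicate (c v) (1::real)) vs))) = n"
    unfolding m by (simp add: sum_mset_sum_list sum_list_triv)
  moreover have "sum_list (concat (map (\<lambda>v. replicate (c v) (1::real)) vs)) = (\<Sum>v\<leftarrow>vs. real (c v))"
    by (induction vs) (auto simp: sum_list_replicate)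
  ultimately have "(\<Sum>v\<leftarrow>vs. real (c v)) = n" by (simp only: sum_mset_sum_list)
  then show sum1: "(\<Sum>v\<leftarrow>vs. c v / n) = 1"
    using \<open>n > 0\<close> by (simp add: divide_inverse sum_list_mult_const)
  have scale: "scale_weights (c v / n) (?ys v) = replicate (c v) (1 / real n, v)" for v
    by (simp add: scale_weights_def)
  have "?C = concat (map (\<lambda>v. replicate (c v) (1 / real n, v)) vs)"
    unfolding scale using \<open>n > 0\<close> by (induction vs) auto
  then have meq: "mset ?l = mset ?C"
    using m[of "\<lambda>v. (1 / real n, v)"] by simp
  have wl: "is_weighting ?l"
    using \<open>n > 0\<close> by (auto simp: is_weighting_def o_def sum_list_triv)
  have "cc ?l = cc ?C" by (rule cc_mset[OF wl meq])
  also have "\<dots> = cc (map (\<lambda>v. (c v / n, cc (?ys v))) ?vs)"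
  proof -
    have ys: "is_weighting (?ys v)" if "v \<in> set ?vs" for v
      using that by (intro is_weighting_replicate) (auto intro: gr0I)
    have pos: "0 < real (c v) / real n" if "v \<in> set ?vs" for v
      using that by auto
    have "is_weighting ([] @ map (\<lambda>v. (c v / n, cc (?ys v))) ?vs)"
      using is_weighting_filter[OF _ sum1, of "\<lambda>v. cc (?ys v)"] by simp
    from cc_concat[OF ys pos this] show ?thesis by simp
  qed
  finally show "cc ?l = cc0 cc (map (\<lambda>v. (c v / n, cc (?ys v))) vs)"
    by (simp add: cc0_map)
qed

text \<open>The intermediate \<open>?b n\<close> has the true frequencies but already the limit
  points \<open>K v\<close>. Its distance from the mean is controlled by
  \<open>tendsto_weighted_0\<close>, also for values \<open>v\<close> met only finitely often, and
  its convergence is continuity in the weights.\<close>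

lemma tendsto_cc_empirical:
  assumes vs: "distinct vs" "\<And>i. y i \<in> set vs"
    and lim: "\<And>v. v \<in> set vs \<Longrightarrow> (\<lambda>n. card {i. i < n \<and> y i = v} / real n) \<longlonglongrightarrow> p v"
  shows "(\<lambda>n. cc (map (\<lambda>i. (1 / real n, y i)) [0..<n])) \<longlonglongrightarrow> cc0 cc (map (\<lambda>v. (p v, K v)) vs)"
proof -
  define c where "c n v = card {i. i < n \<and> y i = v}" for n v
  let ?a = "\<lambda>k v. cc (replicate k (1 / real k, v))"
  let ?S = "\<lambda>n. cc (map (\<lambda>i. (1 / real n, y i)) [0..<n])"
  let ?b = "\<lambda>n. cc0 cc (map (\<lambda>v. (c n v / n, K v)) vs)"
  define L where "L = cc0 cc (map (\<lambda>v. (p v, K v)) vs)"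
  note group = cc_group_values[OF vs(1), of n y for n, folded c_def]
  have cn: "c n v \<le> n" for n v
    using card_mono[of "{..<n}" "{i. i < n \<and> y i = v}"] by (auto simp: c_def)
  have "?b \<longlonglongrightarrow> L"
    unfolding L_def
  proof (rule tendsto_cc0_convexification[where x = "\<lambda>v. v"])
    show "(\<lambda>n. c n v / n) \<longlonglongrightarrow> p v" if "v \<in> set vs" for v using lim[OF that] by (simp add: c_def)
    show "\<forall>\<^sub>F n in sequentially. (\<forall>v\<in>set vs. 0 \<le> c n v / n) \<and> (\<Sum>v\<leftarrow>vs. c n v / n) = 1"
      using eventually_gt_at_top[of 0] by eventually_elim (use group(2) vs(2) in auto)
  qed simp
  moreover have "(\<lambda>n. dist (?S n) (?b n)) \<longlonglongrightarrow> 0"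
  proof (rule Lim_null_comparison)
    show "\<forall>\<^sub>F n in sequentially. norm (dist (?S n) (?b n)) \<le> (\<Sum>v\<leftarrow>vs. c n v / n * dist (?a (c n v) v) (K v))"
      using eventually_gt_at_top[of 0]
    proof eventually_elim
      case (elim n)
      show ?case
        using dist_cc0_le[OF _ group(2)[OF vs(2) elim], of "\<lambda>v. ?a (c n v) v" K]
        by (simp add: group(1)[OF vs(2) elim])
    qed
    have "(\<lambda>n. \<Sum>v\<leftarrow>vs. c n v / n * dist (?a (c n v) v) (K v)) \<longlonglongrightarrow> (\<Sum>v\<leftarrow>vs. 0)"
    proof (rule sum_list_tendsto)
      fix v
      have "(\<lambda>k. dist (?a k v) (K v)) \<longlonglongrightarrow> 0"
        by (rule iffD1[OF tendsto_dist_iff tendsto_convexification])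
      then show "(\<lambda>n. c n v / n * dist (?a (c n v) v) (K v)) \<longlonglongrightarrow> 0"
        by (rule tendsto_weighted_0) (auto intro: cn)
    qed
    then show "(\<lambda>n. \<Sum>v\<leftarrow>vs. c n v / n * dist (?a (c n v) v) (K v)) \<longlonglongrightarrow> 0" by simp
  qed
  ultimately have "(\<lambda>n. dist (?S n) (?b n) + dist (?b n) L) \<longlonglongrightarrow> 0 + 0"
    by (intro tendsto_add) (auto dest: iffD1[OF tendsto_dist_iff])
  then have "(\<lambda>n. dist (?S n) (?b n) + dist (?b n) L) \<longlonglongrightarrow> 0" by simp
  then have "(\<lambda>n. dist (?S n) L) \<longlonglongrightarrow> 0"
    by (rule Lim_null_comparison[rotated]) (simp add: dist_triangle)
  then show ?thesis unfolding L_def by (rule iffD2[OF tendsto_dist_iff])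
qed

end

section \<open>Birkhoff's pointwise ergodic theorem\<close>

lemma subalgebra_invariant_algebra:
  "\<tau> \<in> measurable M M \<Longrightarrow> subalgebra M (invariant_algebra M \<tau>)"
  by (auto simp: subalgebra_def sets_invariant_algebra)

text \<open>The level set of \<open>f\<close> through \<open>\<omega>\<close> belongs to the
  invariant algebra, whose members equal their preimages exactly; hence the equality at every point
  rather than almost everywhere.\<close>

lemma invariant_algebra_measurable_comp:
  fixes f :: "'w \<Rightarrow> 'b::{t1_space, second_countable_topology}"
  assumes "\<tau> \<in> measurable M M" "f \<in> borel_measurable (invariant_algebra M \<tau>)" "\<omega> \<in> space M"
  shows "f (\<tau> \<omega>) = f \<omega>"
proof -
  have "f -` {f \<omega>} \<inter> space M \<in> sets (invariant_algebra M \<tau>)"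
    using measurable_sets[OF assms(2), of "{f \<omega>}"] by simp
  then have "\<tau> -` (f -` {f \<omega>} \<inter> space M) \<inter> space M = f -` {f \<omega>} \<inter> space M"
    using sets_invariant_algebra[OF assms(1)] by simp
  then show ?thesis using assms(3) by blast
qed

lemma measure_preserving_distr:
  assumes "prob_space M" "measure_preserving M \<tau>"
  shows "distr M M \<tau> = M"
proof (rule measure_eqI)
  interpret prob_space M by fact
  fix A assume "A \<in> sets (distr M M \<tau>)"
  then show "emeasure (distr M M \<tau>) A = emeasure M A"
    using assms(2) by (simp add: emeasure_distr measure_preserving_def emeasure_eq_measure)
qed simp

lemma measure_preserving_integrable_comp:
  fixes f :: "'w \<Rightarrow> real"
  assumes "prob_space M" "measure_preserving M \<tau>" "integrable M f"
  shows "integrable M (\<lambda>\<omega>. f (\<tau> \<omega>))" "(\<integral>\<omega>. f (\<tau> \<omega>) \<partial>M) = (\<integral>\<omega>. f \<omega> \<partial>M)"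
proof -
  have \<tau>: "\<tau> \<in> measurable M M" using assms(2) by (simp add: measure_preserving_def)
  have f: "f \<in> borel_measurable M" using assms(3) by simp
  show "integrable M (\<lambda>\<omega>. f (\<tau> \<omega>))"
    using integrable_distr[OF \<tau>, of f] measure_preserving_distr[OF assms(1,2)] assms(3) by simp
  show "(\<integral>\<omega>. f (\<tau> \<omega>) \<partial>M) = (\<integral>\<omega>. f \<omega> \<partial>M)"
    using integral_distr[OF \<tau> f] measure_preserving_distr[OF assms(1,2)] by simp
qed

text \<open>\<open>ergodic_max \<tau> g n\<close> is the maximum of \<open>0\<close> and of the first \<open>n\<close> Birkhoff sums of \<open>g\<close>; the
  recursion makes its measurability and its behaviour under the shift immediate.\<close>

primrec ergodic_max :: "('w \<Rightarrow> 'w) \<Rightarrow> ('w \<Rightarrow> real) \<Rightarrow> nat \<Rightarrow> 'w \<Rightarrow> real" where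
  "ergodic_max \<tau> g 0 \<omega> = 0"
| "ergodic_max \<tau> g (Suc n) \<omega> = max 0 (g \<omega> + ergodic_max \<tau> g n (\<tau> \<omega>))"

lemma ergodic_max_nonneg: "0 \<le> ergodic_max \<tau> g n \<omega>"
  by (cases n) auto

lemma ergodic_max_Suc_mono: "ergodic_max \<tau> g n \<omega> \<le> ergodic_max \<tau> g (Suc n) \<omega>"
proof (induction n arbitrary: \<omega>)
  case (Suc n)
  from Suc[of "\<tau> \<omega>"] show ?case by simp
qed simp

lemma ergodic_max_mono: "m \<le> n \<Longrightarrow> ergodic_max \<tau> g m \<omega> \<le> ergodic_max \<tau> g n \<omega>"
  by (rule lift_Suc_mono_le[of "\<lambda>n. ergodic_max \<tau> g n \<omega>"]) (rule ergodic_max_Suc_mono)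

text \<open>The first term is split off, not the last, to match the recursion of
  \<open>ergodic_max\<close>.\<close>

lemma birkhoff_sum_Suc:
  fixes g :: "'w \<Rightarrow> 'b::comm_monoid_add"
  shows "(\<Sum>i<Suc n. g ((\<tau> ^^ i) \<omega>)) = g \<omega> + (\<Sum>i<n. g ((\<tau> ^^ i) (\<tau> \<omega>)))"
  by (simp add: sum.lessThan_Suc_shift funpow_swap1 del: sum.lessThan_Suc)

lemma birkhoff_sum_le_ergodic_max: "(\<Sum>i<n. g ((\<tau> ^^ i) \<omega>)) \<le> ergodic_max \<tau> g n \<omega>"
proof (induction n arbitrary: \<omega>)
  case (Suc n)
  from Suc[of "\<tau> \<omega>"] show ?case by (simp add: birkhoff_sum_Suc del: sum.lessThan_Suc)
qed simp

locale measure_preserving_system = prob_space M for M :: "'w measure" +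
  fixes \<tau> :: "'w \<Rightarrow> 'w"
  assumes preserving: "measure_preserving M \<tau>"
begin

abbreviation "\<I> \<equiv> invariant_algebra M \<tau>"

lemma measurable_\<tau> [measurable]: "\<tau> \<in> measurable M M"
  using preserving by (simp add: measure_preserving_def)

sublocale finite_measure_subalgebra M \<I>
  by unfold_locales (rule subalgebra_invariant_algebra[OF measurable_\<tau>])

lemma funpow_space: "\<omega> \<in> space M \<Longrightarrow> (\<tau> ^^ i) \<omega> \<in> space M"
  by (induction i) (auto intro: measurable_space[OF measurable_\<tau>])

section \<open>The maximal inequality where Birkhoff sums are unbounded\<close>

lemma integrable_ergodic_max: "integrable M g \<Longrightarrow> integrable M (ergodic_max \<tau> g n)"
proof (induction n)
  case (Suc n)
  then have "integrable M (\<lambda>\<omega>. ergodic_max \<tau> g n (\<tau> \<omega>))"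
    by (intro measure_preserving_integrable_comp(1)[OF prob_space_axioms preserving])
  with Suc.prems show ?case by auto
next
  case 0
  have "ergodic_max \<tau> g 0 = (\<lambda>_. 0)" by auto
  then show ?case by simp
qed

text \<open>The event that the supremum of the Birkhoff sums is infinite. Levels \<open>c\<close>
  are natural numbers, so only countable operations occur and measurability is automatic.\<close>

definition unbounded_set :: "('w \<Rightarrow> real) \<Rightarrow> 'w set" where
  "unbounded_set g = {\<omega> \<in> space M. \<forall>c::nat. \<exists>n. real c < ergodic_max \<tau> g n \<omega>}"

lemma ergodic_max_tendsto_at_top:
  assumes "\<omega> \<in> unbounded_set g"
  shows "filterlim (\<lambda>n. ergodic_max \<tau> g n \<omega>) at_top sequentially"
  unfolding filterlim_at_top
proof
  fix Z :: real
  obtain c :: nat where "Z \<le> c" using real_arch_simple by blast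
  moreover obtain n where "real c < ergodic_max \<tau> g n \<omega>"
    using assms by (auto simp: unbounded_set_def)
  ultimately have "Z \<le> ergodic_max \<tau> g m \<omega>" if "m \<ge> n" for m
    using ergodic_max_mono[OF that, of \<tau> g \<omega>] by linarith
  then show "\<forall>\<^sub>F n in sequentially. Z \<le> ergodic_max \<tau> g n \<omega>"
    by (auto simp: eventually_sequentially)
qed

text \<open>By the recursion, \<open>ergodic_max \<tau> g (Suc n) \<omega>\<close> and
  \<open>ergodic_max \<tau> g n (\<tau> \<omega>)\<close> differ by \<open>g \<omega>\<close> apart
  from the truncation at \<open>0\<close>, so shifting the level by this fixed amount carries
  unboundedness from one point to the other.\<close>

lemma unbounded_set_shift:
  assumes "\<omega> \<in> space M"
  shows "\<tau> \<omega> \<in> unbounded_set g \<longleftrightarrow> \<omega> \<in> unbounded_set g"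
proof
  assume L: "\<tau> \<omega> \<in> unbounded_set g"
  have "\<exists>n. real c < ergodic_max \<tau> g n \<omega>" for c :: nat
  proof -
    obtain d :: nat where "c - g \<omega> \<le> d" using real_arch_simple by blast
    moreover obtain n where "real d < ergodic_max \<tau> g n (\<tau> \<omega>)"
      using L by (auto simp: unbounded_set_def)
    ultimately have "real c < ergodic_max \<tau> g (Suc n) \<omega>" by simp
    then show ?thesis by blast
  qed
  with assms show "\<omega> \<in> unbounded_set g" by (auto simp: unbounded_set_def)
next
  assume R: "\<omega> \<in> unbounded_set g"
  have "\<exists>n. real c < ergodic_max \<tau> g n (\<tau> \<omega>)" for c :: nat
  proof -
    obtain d :: nat where "c + g \<omega> \<le> d" using real_arch_simple by blast
    moreover obtain n where n: "real d < ergodic_max \<tau> g n \<omega>"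
      using R by (auto simp: unbounded_set_def)
    moreover obtain m where "n = Suc m" using n by (cases n) auto
    ultimately have "real c < ergodic_max \<tau> g m (\<tau> \<omega>)" by (auto simp: less_max_iff_disj)
    then show ?thesis by blast
  qed
  with measurable_space[OF measurable_\<tau> assms] show "\<tau> \<omega> \<in> unbounded_set g"
    by (auto simp: unbounded_set_def)
qed

lemma unbounded_set_invariant:
  assumes "integrable M g"
  shows "unbounded_set g \<in> sets \<I>"
proof -
  have [measurable]: "ergodic_max \<tau> g n \<in> borel_measurable M" for n
    using integrable_ergodic_max[OF assms] by simp
  have "unbounded_set g \<in> sets M" unfolding unbounded_set_def by measurable
  moreover have "\<tau> -` unbounded_set g \<inter> space M = unbounded_set g"
    using unbounded_set_shift[of _ g] unbounded_set_def by blast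
  ultimately show ?thesis using sets_invariant_algebra[OF measurable_\<tau>] by simp
qed

text \<open>On \<open>unbounded_set g\<close>, which is invariant, the increment
  \<open>ergodic_max (Suc n) - ergodic_max n \<circ> \<tau>\<close> equals \<open>max (- ergodic_max n \<circ> \<tau>) g\<close> and hence tends to
  \<open>g\<close>, while its integral is nonnegative by monotonicity.\<close>

lemma maximal_ergodic:
  assumes g: "integrable M g"
  shows "0 \<le> (\<integral>\<omega>\<in>unbounded_set g. g \<omega> \<partial>M)"
proof -
  let ?H = "ergodic_max \<tau> g" and ?A = "unbounded_set g"
  have A [measurable]: "?A \<in> sets M"
    using unbounded_set_invariant[OF g] subalg by (auto simp: subalgebra_def)
  have H: "integrable M (\<lambda>\<omega>. indicator ?A \<omega> * ?H n \<omega>)" for n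
    using integrable_mult_indicator[OF A integrable_ergodic_max[OF g, of n]] by simp
  \<comment> \<open>As the indicator is invariant, it can be shifted together with
    \<open>?H n\<close>, and measure preservation applies to the whole product.\<close>
  have shift: "indicator ?A (\<tau> \<omega>) = (indicator ?A \<omega> :: real)" if "\<omega> \<in> space M" for \<omega>
    using unbounded_set_shift[OF that] by (simp add: indicator_def)
  have H\<tau>: "integrable M (\<lambda>\<omega>. indicator ?A \<omega> * ?H n (\<tau> \<omega>))"
    "(\<integral>\<omega>. indicator ?A \<omega> * ?H n (\<tau> \<omega>) \<partial>M) = (\<integral>\<omega>. indicator ?A \<omega> * ?H n \<omega> \<partial>M)" for n
  proof -
    note c = measure_preserving_integrable_comp[OF prob_space_axioms preserving H[of n]]
    show "integrable M (\<lambda>\<omega>. indicator ?A \<omega> * ?H n (\<tau> \<omega>))"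
      by (rule Bochner_Integration.integrable_cong[THEN iffD1, OF refl _ c(1)]) (simp add: shift)
    have "(\<integral>\<omega>. indicator ?A \<omega> * ?H n (\<tau> \<omega>) \<partial>M) = (\<integral>\<omega>. indicator ?A (\<tau> \<omega>) * ?H n (\<tau> \<omega>) \<partial>M)"
      by (rule Bochner_Integration.integral_cong) (simp_all add: shift)
    with c(2) show "(\<integral>\<omega>. indicator ?A \<omega> * ?H n (\<tau> \<omega>) \<partial>M) = (\<integral>\<omega>. indicator ?A \<omega> * ?H n \<omega> \<partial>M)"
      by simp
  qed
  let ?D = "\<lambda>n \<omega>. indicator ?A \<omega> * ?H (Suc n) \<omega> - indicator ?A \<omega> * ?H n (\<tau> \<omega>)"
  have D: "0 \<le> (\<integral>\<omega>. ?D n \<omega> \<partial>M)" for n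
  proof -
    have "(\<integral>\<omega>. ?D n \<omega> \<partial>M) = (\<integral>\<omega>. indicator ?A \<omega> * ?H (Suc n) \<omega> \<partial>M) - (\<integral>\<omega>. indicator ?A \<omega> * ?H n \<omega> \<partial>M)"
      using Bochner_Integration.integral_diff[OF H[of "Suc n"] H\<tau>(1)[of n]] H\<tau>(2)[of n] by simp
    moreover have "(\<integral>\<omega>. indicator ?A \<omega> * ?H n \<omega> \<partial>M) \<le> (\<integral>\<omega>. indicator ?A \<omega> * ?H (Suc n) \<omega> \<partial>M)"
      by (intro integral_mono H mult_left_mono ergodic_max_Suc_mono) auto
    ultimately show ?thesis by simp
  qed
  have "(\<lambda>n. \<integral>\<omega>. ?D n \<omega> \<partial>M) \<longlonglongrightarrow> (\<integral>\<omega>. indicator ?A \<omega> * g \<omega> \<partial>M)"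
  proof (rule integral_dominated_convergence[where w = "\<lambda>\<omega>. \<bar>g \<omega>\<bar>"])
    show "(\<lambda>\<omega>. indicator ?A \<omega> * g \<omega>) \<in> borel_measurable M" using g by measurable
    show "?D n \<in> borel_measurable M" for n
      using H[of "Suc n"] H\<tau>(1)[of n] by (intro borel_measurable_diff) auto
    show "integrable M (\<lambda>\<omega>. \<bar>g \<omega>\<bar>)" using g by simp
    \<comment> \<open>With \<open>h = ?H n (\<tau> \<omega>)\<close> nonnegative,
      \<open>max (- h) (g \<omega>)\<close> is \<open>g \<omega>\<close> or lies between
      \<open>g \<omega>\<close> and \<open>0\<close>.\<close>
    show "AE \<omega> in M. norm (?D n \<omega>) \<le> \<bar>g \<omega>\<bar>" for n
      using ergodic_max_nonneg[of \<tau> g n] by (auto simp: indicator_def max_def)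
    show "AE \<omega> in M. (\<lambda>n. ?D n \<omega>) \<longlonglongrightarrow> indicator ?A \<omega> * g \<omega>"
    proof (rule AE_I2)
      fix \<omega> assume \<omega>: "\<omega> \<in> space M"
      show "(\<lambda>n. ?D n \<omega>) \<longlonglongrightarrow> indicator ?A \<omega> * g \<omega>"
      proof (cases "\<omega> \<in> ?A")
        case True
        then have "filterlim (\<lambda>n. ?H n (\<tau> \<omega>)) at_top sequentially"
          using unbounded_set_shift[OF \<omega>] by (intro ergodic_max_tendsto_at_top) simp
        then have "\<forall>\<^sub>F n in sequentially. - g \<omega> \<le> ?H n (\<tau> \<omega>)"
          by (simp add: filterlim_at_top)
        then have "\<forall>\<^sub>F n in sequentially. ?D n \<omega> = g \<omega>"
          by eventually_elim (use True in \<open>simp add: max_def\<close>)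
        then show ?thesis using True by (simp add: tendsto_eventually)
      qed simp
    qed
  qed
  then have "0 \<le> (\<integral>\<omega>. indicator ?A \<omega> * g \<omega> \<partial>M)"
    by (rule LIMSEQ_le_const) (use D in blast)
  then show ?thesis by (simp add: set_lebesgue_integral_def)
qed

text \<open>On the invariant set \<open>A\<close>, \<open>f\<close> and its conditional expectation
  have equal integrals, so the integral of \<open>g\<close> there is
  \<open>- (e / 2) * prob A\<close>; \<open>maximal_ergodic\<close> forces
  \<open>prob A = 0\<close>. Off \<open>A\<close> the Birkhoff sums of \<open>g\<close> are bounded
  above by a constant, which vanishes after division by \<open>n\<close> and leaves
  \<open>e / 2\<close> to spare.\<close>

lemma birkhoff_upper:
  assumes f: "integrable M f" and e: "e > 0"
  shows "AE \<omega> in M. \<forall>\<^sub>F n in sequentially.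
    (\<Sum>i<n. f ((\<tau> ^^ i) \<omega>)) / n < real_cond_exp M \<I> f \<omega> + e"
proof -
  let ?F = "real_cond_exp M \<I> f"
  define g where "g \<omega> = f \<omega> - ?F \<omega> - e / 2" for \<omega>
  define A where "A = unbounded_set g"
  have F: "integrable M ?F" by (rule real_cond_exp_int(1)[OF f])
  have g: "integrable M g" unfolding g_def using f F by auto
  have AI: "A \<in> sets \<I>" unfolding A_def by (rule unbounded_set_invariant[OF g])
  then have A: "A \<in> sets M" using subalg by (auto simp: subalgebra_def)
  have "(\<integral>\<omega>\<in>A. g \<omega> \<partial>M) = (\<integral>\<omega>\<in>A. f \<omega> \<partial>M) - (\<integral>\<omega>\<in>A. ?F \<omega> \<partial>M) - (\<integral>\<omega>\<in>A. e / 2 \<partial>M)"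
  proof -
    have s: "set_integrable M A f" "set_integrable M A ?F" "set_integrable M A (\<lambda>_. e / 2)"
      unfolding set_integrable_def using f F A by (auto intro!: integrable_mult_indicator simp del: real_scaleR_def)
    show ?thesis
      unfolding g_def set_integral_diff(2)[OF set_integral_diff(1)[OF s(1,2)] s(3)]
        set_integral_diff(2)[OF s(1,2)] ..
  qed
  also have "\<dots> = - (e / 2) * prob A"
    using real_cond_exp_intA[OF f AI] sets.sets_into_space[OF A] by (simp add: Int_absorb2 set_lebesgue_integral_def)
  finally have "prob A \<le> 0"
    using maximal_ergodic[OF g] e unfolding A_def by (simp add: mult_le_0_iff)
  then have "AE \<omega> in M. \<omega> \<notin> A"
    using A by (intro AE_not_in) (simp add: null_sets_def emeasure_eq_measure measure_le_0_iff)
  with AE_space show ?thesis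
  proof eventually_elim
    case (elim \<omega>)
    then obtain c :: nat where c: "ergodic_max \<tau> g n \<omega> \<le> c" for n
      unfolding A_def unbounded_set_def by (auto simp: not_less)
    \<comment> \<open>The version \<open>?F\<close> is measurable for \<open>\<I>\<close>, hence
      constant along every orbit in the space, with no exceptional set.\<close>
    have Finv: "?F ((\<tau> ^^ i) \<omega>) = ?F \<omega>" for i
    proof (induction i)
      case (Suc i)
      then show ?case
        using invariant_algebra_measurable_comp[OF measurable_\<tau> borel_measurable_cond_exp
            funpow_space[OF elim(1), of i]] by simp
    qed simp
    have up: "(\<Sum>i<n. f ((\<tau> ^^ i) \<omega>)) \<le> c + n * (?F \<omega> + e / 2)" for n
      using birkhoff_sum_le_ergodic_max[of g \<tau> \<omega> n] c[of n]
      by (simp add: g_def Finv sum_subtractf algebra_simps)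
    have "\<forall>\<^sub>F n in sequentially. real c / real n < e / 2"
      using e by (intro order_tendstoD(2)[OF lim_const_over_n]) auto
    with eventually_gt_at_top[of 0] show ?case
    proof eventually_elim
      case (elim n)
      have "(\<Sum>i<n. f ((\<tau> ^^ i) \<omega>)) / n \<le> (c + n * (?F \<omega> + e / 2)) / n"
        using up[of n] by (intro divide_right_mono) auto
      also have "\<dots> = c / n + (?F \<omega> + e / 2)" using elim by (simp add: field_simps)
      also have "\<dots> < ?F \<omega> + e" using elim by linarith
      finally show ?case .
    qed
  qed
qed

text \<open>The upper bound for \<open>- f\<close> is the lower bound for \<open>f\<close>. Errors
  \<open>1 / real (Suc k)\<close> keep the exceptional null sets countable in number.\<close>

theorem birkhoff_pointwise:
  fixes f :: "'w \<Rightarrow> real"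
  assumes f: "integrable M f"
  shows "AE \<omega> in M. (\<lambda>n. (\<Sum>i<n. f ((\<tau> ^^ i) \<omega>)) / n) \<longlonglongrightarrow> real_cond_exp M \<I> f \<omega>"
proof -
  let ?F = "real_cond_exp M \<I> f"
  have "integrable M (\<lambda>\<omega>. - f \<omega>)" using f by simp
  then have "AE \<omega> in M. \<forall>k. \<forall>\<^sub>F n in sequentially.
    (\<Sum>i<n. - f ((\<tau> ^^ i) \<omega>)) / n < real_cond_exp M \<I> (\<lambda>\<omega>. - f \<omega>) \<omega> + 1 / real (Suc k)"
    unfolding AE_all_countable by (intro allI birkhoff_upper) auto
  moreover have "AE \<omega> in M. \<forall>k. \<forall>\<^sub>F n in sequentially.
    (\<Sum>i<n. f ((\<tau> ^^ i) \<omega>)) / n < ?F \<omega> + 1 / real (Suc k)"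
    unfolding AE_all_countable using f by (intro allI birkhoff_upper) auto
  moreover have "AE \<omega> in M. real_cond_exp M \<I> (\<lambda>\<omega>. (-1) * f \<omega>) \<omega> = (-1) * ?F \<omega>"
    by (rule real_cond_exp_cmult[OF f])
  ultimately show ?thesis
  proof eventually_elim
    case (elim \<omega>)
    note minus = elim(3)[simplified]
    show ?case
    proof (rule tendstoI)
      fix e :: real assume "e > 0"
      then obtain k where k: "1 / real (Suc k) < e" using nat_approx_posE by metis
      from elim(1)[rule_format, of k] elim(2)[rule_format, of k]
      show "\<forall>\<^sub>F n in sequentially. dist ((\<Sum>i<n. f ((\<tau> ^^ i) \<omega>)) / n) (?F \<omega>) < e"
      proof eventually_elim
        case (elim n)
        have "(\<Sum>i<n. - f ((\<tau> ^^ i) \<omega>)) / n = - ((\<Sum>i<n. f ((\<tau> ^^ i) \<omega>)) / n)"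
          by (simp add: sum_negf)
        with elim k minus show ?case by (simp add: dist_real_def abs_less_iff)
      qed
    qed
  qed
qed

end

section \<open>Approximation by simple elements\<close>

lemma nearest_point_eq:
  "dist (nearest_point u n x) x = Min ((\<lambda>j. dist (u j) x) ` {..n})"
  "nearest_point u n x \<in> u ` {..n}"
proof -
  let ?D = "(\<lambda>j. dist (u j) x) ` {..n}"
  have "Min ?D \<in> ?D" by (rule Min_in) auto
  then have "\<exists>i. i \<le> n \<and> dist (u i) x = Min ?D" by force
  then have "nearest_index u n x \<le> n \<and> dist (u (nearest_index u n x)) x = Min ?D"
    unfolding nearest_index_def by (rule LeastI_ex)
  then show "dist (nearest_point u n x) x = Min ?D" "nearest_point u n x \<in> u ` {..n}"
    by (auto simp: nearest_point_def)
qed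

lemma dist_nearest_point_le: "j \<le> n \<Longrightarrow> dist (nearest_point u n x) x \<le> dist (u j) x"
  unfolding nearest_point_eq by (intro Min_le) auto

lemma dist_nearest_point_Suc: "dist (nearest_point u (Suc n) x) x \<le> dist (nearest_point u n x) x"
  unfolding nearest_point_eq by (intro Min_antimono) auto

lemma dist_nearest_point_tendsto_0:
  assumes "closure (u ` {1..}) = UNIV"
  shows "(\<lambda>n. dist (nearest_point u n x) x) \<longlonglongrightarrow> 0"
proof (rule tendstoI)
  fix e :: real assume "e > 0"
  have "x \<in> closure (u ` {1..})" using assms by simp
  with \<open>e > 0\<close> obtain j where j: "dist (u j) x < e" by (auto simp: closure_approachable)
  show "\<forall>\<^sub>F n in sequentially. dist (dist (nearest_point u n x) x) 0 < e"
    using eventually_ge_at_top[of j]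
    by eventually_elim (use dist_nearest_point_le[of j _ u x] j in force)
qed

lemma borel_measurable_nearest_point:
  fixes u :: "nat \<Rightarrow> 'a::{metric_space, second_countable_topology}"
  shows "nearest_point u n \<in> borel_measurable borel"
proof -
  \<comment> \<open>Being a minimiser becomes a finite conjunction of comparisons of distances, from
    which measurability of the least index is evident.\<close>
  have min: "dist (u i) x = Min ((\<lambda>j. dist (u j) x) ` {..n}) \<longleftrightarrow> (\<forall>j\<in>{..n}. dist (u i) x \<le> dist (u j) x)"
    if "i \<le> n" for i x
    using that by (auto intro!: antisym Min.boundedI)
  have [measurable]: "nearest_index u n \<in> measurable borel (count_space UNIV)"
    unfolding nearest_index_def by (simp add: min cong: conj_cong)
  show ?thesis unfolding nearest_point_def by measurable
qed

text \<open>The conditional expectations decrease almost surely to some nonnegative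
  \<open>L\<close>. By dominated convergence the integral of \<open>L\<close> is the limit of the
  integrals of \<open>f n\<close>, which is \<open>0\<close>, so \<open>L\<close> vanishes almost
  surely.\<close>

lemma (in sigma_finite_subalgebra) real_cond_exp_decseq_tendsto_0:
  fixes f :: "nat \<Rightarrow> 'a \<Rightarrow> real"
  assumes f: "\<And>n. integrable M (f n)" and nonneg: "\<And>n x. 0 \<le> f n x"
    and dec: "\<And>n x. f (Suc n) x \<le> f n x" and lim: "\<And>x. (\<lambda>n. f n x) \<longlonglongrightarrow> 0"
  shows "AE x in M. decseq (\<lambda>n. real_cond_exp M F (f n) x) \<and> (\<lambda>n. real_cond_exp M F (f n) x) \<longlonglongrightarrow> 0"
proof -
  let ?h = "\<lambda>n. real_cond_exp M F (f n)"
  have h: "integrable M (?h n)" "(\<integral>x. ?h n x \<partial>M) = (\<integral>x. f n x \<partial>M)" for n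
    using real_cond_exp_int[OF f] by auto
  have mono: "AE x in M. \<forall>n. ?h (Suc n) x \<le> ?h n x"
    unfolding AE_all_countable using f dec by (auto intro!: real_cond_exp_mono)
  have pos: "AE x in M. \<forall>n. 0 \<le> ?h n x"
    unfolding AE_all_countable using f nonneg by auto
  define L where "L x = lim (\<lambda>n. ?h n x)" for x
  have conv: "AE x in M. (\<forall>n. 0 \<le> ?h n x \<and> ?h n x \<le> ?h 0 x) \<and> decseq (\<lambda>n. ?h n x) \<and> (\<lambda>n. ?h n x) \<longlonglongrightarrow> L x"
    using mono pos
  proof eventually_elim
    case (elim x)
    then have d: "decseq (\<lambda>n. ?h n x)" by (auto simp: decseq_Suc_iff)
    moreover have "convergent (\<lambda>n. ?h n x)"
      using decseq_convergent[OF d, of 0] elim(2) unfolding convergent_def by metis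
    ultimately show ?case
      using elim d by (auto simp: L_def convergent_LIMSEQ_iff dest: decseqD)
  qed
  have L [measurable]: "L \<in> borel_measurable M"
    unfolding L_def using h(1) by (intro borel_measurable_lim_metric) auto
  have int: "integrable M L" "(\<lambda>n. \<integral>x. ?h n x \<partial>M) \<longlonglongrightarrow> (\<integral>x. L x \<partial>M)"
  proof -
    have bound: "AE x in M. norm (?h n x) \<le> ?h 0 x" for n using conv by eventually_elim auto
    have L_lim: "AE x in M. (\<lambda>n. ?h n x) \<longlonglongrightarrow> L x" using conv by eventually_elim auto
    have meas: "?h n \<in> borel_measurable M" for n using h(1) by auto
    show "integrable M L" by (rule integrable_dominated_convergence[OF L meas h(1) L_lim bound])
    show "(\<lambda>n. \<integral>x. ?h n x \<partial>M) \<longlonglongrightarrow> (\<integral>x. L x \<partial>M)"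
      by (rule integral_dominated_convergence[OF L meas h(1) L_lim bound])
  qed
  have "(\<lambda>n. \<integral>x. f n x \<partial>M) \<longlonglongrightarrow> (\<integral>x. 0 \<partial>M)"
  proof (rule integral_dominated_convergence)
    show "AE x in M. norm (f n x) \<le> f 0 x" for n
      using nonneg decseqD[OF decseq_SucI[of "\<lambda>n. f n _", OF dec], of 0 n] by simp
  qed (use f lim in auto)
  with int(2) have "(\<integral>x. L x \<partial>M) = 0" unfolding h(2) by (auto dest: LIMSEQ_unique)
  moreover have "AE x in M. 0 \<le> L x"
    using conv by eventually_elim (auto intro: LIMSEQ_le_const)
  ultimately have "AE x in M. L x = 0"
    using integral_nonneg_eq_0_iff_AE[OF int(1)] by simp
  with conv show ?thesis by eventually_elim auto
qed

text \<open>Convergence of \<open>y\<close> is part of what is proved. Eventually \<open>s n\<close>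
  is within \<open>h m + e\<close> of \<open>y m\<close>, so \<open>s\<close> is Cauchy; its limit
  \<open>l\<close> satisfies \<open>dist l (y m) <= h m\<close>, hence \<open>y\<close> tends to
  \<open>l\<close> as well and \<open>lim y\<close> is a true limit.\<close>

lemma tendsto_lim_of_approximations:
  fixes s :: "nat \<Rightarrow> 'a::complete_space"
  assumes approx: "\<And>m. s' m \<longlonglongrightarrow> y m"
    and dist: "\<And>m. \<forall>\<^sub>F n in sequentially. dist (s n) (s' m n) \<le> A m n"
    and A: "\<And>m. A m \<longlonglongrightarrow> h m" and h: "h \<longlonglongrightarrow> (0::real)"
  shows "s \<longlonglongrightarrow> lim y"
proof -
  have ev: "\<forall>\<^sub>F n in sequentially. dist (s n) (y m) < h m + e" if "e > 0" for m e
  proof -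
    have "\<forall>\<^sub>F n in sequentially. dist (s' m n) (y m) < e / 2"
      using that by (intro tendstoD[OF approx]) simp
    moreover have "\<forall>\<^sub>F n in sequentially. A m n < h m + e / 2"
      using that by (intro order_tendstoD(2)[OF A]) simp
    ultimately show ?thesis
      using dist[of m]
    proof eventually_elim
      case (elim n)
      then show ?case using dist_triangle[of "s n" "y m" "s' m n"] by simp
    qed
  qed
  have "Cauchy s"
  proof (rule metric_CauchyI)
    fix e :: real assume "e > 0"
    then obtain m where "h m < e / 4"
      using order_tendstoD(2)[OF h, of "e / 4"] by (auto simp: eventually_sequentially)
    moreover obtain N where "\<And>n. n \<ge> N \<Longrightarrow> dist (s n) (y m) < h m + e / 4"
      using ev[of "e / 4" m] \<open>e > 0\<close> by (auto simp: eventually_sequentially)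
    ultimately have "dist (s n) (y m) < e / 2" if "n \<ge> N" for n
      using that by fastforce
    then show "\<exists>N. \<forall>i\<ge>N. \<forall>j\<ge>N. dist (s i) (s j) < e"
      using dist_triangle_half_l by blast
  qed
  then obtain l where l: "s \<longlonglongrightarrow> l" using Cauchy_convergent_iff convergent_def by blast
  have "dist l (y m) \<le> h m" for m
  proof (rule field_le_epsilon)
    fix e :: real assume "e > 0"
    have "(\<lambda>n. dist (s n) (y m)) \<longlonglongrightarrow> dist l (y m)" by (intro tendsto_intros l)
    then show "dist l (y m) \<le> h m + e"
      by (rule tendsto_upperbound) (use ev[OF \<open>e > 0\<close>, of m] in \<open>auto elim: eventually_mono\<close>)
  qed
  then have "(\<lambda>m. dist (y m) l) \<longlonglongrightarrow> 0"
    by (intro Lim_null_comparison[OF _ h]) (auto simp: dist_commute)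
  then have "y \<longlonglongrightarrow> l" by (rule iffD2[OF tendsto_dist_iff])
  with l show ?thesis by (simp add: limI)
qed

section \<open>The ergodic theorem, first for simple elements\<close>

lemma (in cc_space) dist_cc_mean_le:
  assumes "n > 0"
  shows "dist (cc (map (\<lambda>i. (1 / real n, f i)) [0..<n])) (cc (map (\<lambda>i. (1 / real n, g i)) [0..<n]))
    \<le> (\<Sum>i<n. dist (f i) (g i)) / n"
proof -
  have "dist (cc (map (\<lambda>i. (1 / real n, f i)) [0..<n])) (cc (map (\<lambda>i. (1 / real n, g i)) [0..<n]))
      \<le> (\<Sum>i\<leftarrow>[0..<n]. 1 / real n * dist (f i) (g i))"
    using assms by (intro dist_cc_le) (auto simp: sum_list_triv)
  also have "\<dots> = (\<Sum>i<n. dist (f i) (g i)) / n"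
    by (simp only: sum_list_const_mult) (simp add: sum_list_distinct_conv_sum_set atLeast0LessThan)
  finally show ?thesis .
qed

text \<open>Birkhoff's theorem for the indicators of the finitely many level sets gives the limits
  of the visit frequencies, which \<open>tendsto_cc_empirical\<close> turns into convergence of the
  means.\<close>

lemma simple_ergodic_theorem:
  fixes cc :: "(real \<times> 'a::polish_space) list \<Rightarrow> 'a"
  assumes "cc_space cc" and "measure_preserving_system M \<tau>"
    and Y: "Y \<in> borel_measurable M" "finite (Y ` space M)"
  shows "AE \<omega> in M. (\<lambda>n. cc (map (\<lambda>i. (1 / real n, Y ((\<tau> ^^ i) \<omega>))) [0..<n]))
      \<longlonglongrightarrow> simple_cond_exp cc M (invariant_algebra M \<tau>) Y \<omega>"
proof -
  interpret cc_space cc by fact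
  interpret measure_preserving_system M \<tau> by fact
  \<comment> \<open>Literally the enumeration used in \<open>simple_cond_exp\<close>, so that
    unfolding that definition meets the same list.\<close>
  define vs where "vs = (SOME xs. distinct xs \<and> set xs = Y ` space M)"
  have vs: "distinct vs" "set vs = Y ` space M"
    using someI_ex[of "\<lambda>xs. distinct xs \<and> set xs = Y ` space M"] finite_distinct_list[OF Y(2)]
    unfolding vs_def by blast+
  let ?B = "\<lambda>x. Y -` {x} \<inter> space M"
  have "AE \<omega> in M. \<forall>x\<in>set vs.
    (\<lambda>n. (\<Sum>i<n. indicator (?B x) ((\<tau> ^^ i) \<omega>)) / n) \<longlonglongrightarrow> real_cond_exp M \<I> (indicator (?B x)) \<omega>"
  proof (rule AE_finite_allI)
    fix x
    have "?B x \<in> sets M" using Y(1) by measurable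
    then show "AE \<omega> in M. (\<lambda>n. (\<Sum>i<n. indicator (?B x) ((\<tau> ^^ i) \<omega>)) / n)
        \<longlonglongrightarrow> real_cond_exp M \<I> (indicator (?B x)) \<omega>"
      by (intro birkhoff_pointwise) (simp add: emeasure_eq_measure)
  qed simp
  with AE_space show ?thesis
  proof eventually_elim
    case (elim \<omega>)
    have "(\<Sum>i<n. indicator (?B x) ((\<tau> ^^ i) \<omega>)) = real (card {i. i < n \<and> Y ((\<tau> ^^ i) \<omega>) = x})" for x n
    proof -
      have "(\<Sum>i<n. indicator (?B x) ((\<tau> ^^ i) \<omega>)) = (\<Sum>i<n. if Y ((\<tau> ^^ i) \<omega>) = x then 1 else (0::real))"
        using funpow_space[OF elim(1)] by (intro sum.cong) (auto simp: indicator_def)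
      also have "\<dots> = real (card {i\<in>{..<n}. Y ((\<tau> ^^ i) \<omega>) = x})"
        by (subst sum.inter_filter[symmetric]) auto
      finally show ?thesis by (simp add: Collect_conj_eq lessThan_def)
    qed
    then show ?case
      unfolding simple_cond_exp_def vs_def[symmetric]
      by (intro tendsto_cc_empirical vs) (use elim vs funpow_space in auto)
  qed
qed

theorem theorem4p14:
  fixes cc :: "(real \<times> 'a::polish_space) list \<Rightarrow> 'a"
    and u :: "nat \<Rightarrow> 'a"
    and M :: "'w measure"
    and \<tau> :: "'w \<Rightarrow> 'w"
    and X :: "'w \<Rightarrow> 'a"
  assumes "cc_space cc"
    and "approximating_sequence cc u"
    and "prob_space M" and "complete_measure M" and "atomless M"
    and "measure_preserving M \<tau>"
    and "integrable_element M X"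
  shows "AE \<omega> in M.
    (\<lambda>n. cc (map (\<lambda>i. (1 / real n, X ((\<tau> ^^ i) \<omega>))) [0..<n]))
      \<longlonglongrightarrow> cc_cond_exp cc u M (invariant_algebra M \<tau>) X \<omega>"
proof -
  interpret cc_space cc by fact
  interpret prob_space M by fact
  interpret measure_preserving_system M \<tau> by unfold_locales fact
  have X [measurable]: "X \<in> borel_measurable M"
    using assms(7) by (simp add: integrable_element_def)
  obtain v where v: "integrable M (\<lambda>\<omega>. dist v (X \<omega>))"
    using assms(7) by (auto simp: integrable_element_def)
  let ?X = "\<lambda>m \<omega>. nearest_point u m (X \<omega>)"
  let ?f = "\<lambda>m \<omega>. dist (?X m \<omega>) (X \<omega>)"
  note [measurable] = borel_measurable_nearest_point
  have Xm: "?X m \<in> borel_measurable M" "finite (?X m ` space M)" for m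
  proof -
    show "?X m \<in> borel_measurable M" by measurable
    have "?X m ` space M \<subseteq> u ` {..m}" using nearest_point_eq(2) by blast
    then show "finite (?X m ` space M)" by (rule finite_subset) simp
  qed
  \<comment> \<open>Index \<open>0\<close> always competes for the nearest point, so
    \<open>dist (u 0) (X \<omega>)\<close> bounds \<open>?f m \<omega>\<close> for every
    \<open>m\<close>.\<close>
  have f: "integrable M (?f m)" for m
  proof (rule Bochner_Integration.integrable_bound)
    show "integrable M (\<lambda>\<omega>. dist (u 0) v + dist v (X \<omega>))" using v by auto
    show "?f m \<in> borel_measurable M" by measurable
    show "AE \<omega> in M. norm (?f m \<omega>) \<le> norm (dist (u 0) v + dist v (X \<omega>))"
    proof (rule AE_I2)
      fix \<omega>
      have "?f m \<omega> \<le> dist (u 0) (X \<omega>)" by (rule dist_nearest_point_le) simp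
      also have "\<dots> \<le> dist (u 0) v + dist v (X \<omega>)" by (rule dist_triangle)
      finally show "norm (?f m \<omega>) \<le> norm (dist (u 0) v + dist v (X \<omega>))" by simp
    qed
  qed
  have "closure (u ` {1..}) = UNIV" using assms(2) by (simp add: approximating_sequence_def)
  then have "AE \<omega> in M. (\<lambda>m. real_cond_exp M \<I> (?f m) \<omega>) \<longlonglongrightarrow> 0"
    using real_cond_exp_decseq_tendsto_0[of ?f, OF f _ dist_nearest_point_Suc dist_nearest_point_tendsto_0]
    by simp
  moreover have "AE \<omega> in M. \<forall>m. (\<lambda>n. (\<Sum>i<n. ?f m ((\<tau> ^^ i) \<omega>)) / n) \<longlonglongrightarrow> real_cond_exp M \<I> (?f m) \<omega>"
    unfolding AE_all_countable by (intro allI birkhoff_pointwise f)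
  moreover have "AE \<omega> in M. \<forall>m. (\<lambda>n. cc (map (\<lambda>i. (1 / real n, ?X m ((\<tau> ^^ i) \<omega>))) [0..<n]))
      \<longlonglongrightarrow> simple_cond_exp cc M \<I> (?X m) \<omega>"
    unfolding AE_all_countable
    by (intro allI simple_ergodic_theorem assms(1) measure_preserving_system_axioms Xm)
  ultimately show ?thesis
  proof eventually_elim
    case (elim \<omega>)
    show ?case
      unfolding cc_cond_exp_def
    \<comment> \<open>Here \<open>y m\<close> is the conditional expectation of \<open>?X m\<close>,
      with \<open>lim y\<close> equal to \<open>cc_cond_exp\<close> by definition;
      \<open>A m\<close> are the Birkhoff averages of \<open>?f m\<close>, and \<open>h m\<close> is
      their limit.\<close>
    proof (rule tendsto_lim_of_approximations)
      show "\<forall>\<^sub>F n in sequentially.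
          dist (cc (map (\<lambda>i. (1 / real n, X ((\<tau> ^^ i) \<omega>))) [0..<n]))
            (cc (map (\<lambda>i. (1 / real n, ?X m ((\<tau> ^^ i) \<omega>))) [0..<n]))
          \<le> (\<Sum>i<n. ?f m ((\<tau> ^^ i) \<omega>)) / n" for m
        \<comment> \<open>Time \<open>n = 0\<close> is left out because \<open>cc\<close> is
          unconstrained on the empty list.\<close>
        using eventually_gt_at_top[of 0]
      proof eventually_elim
        case (elim n)
        from dist_cc_mean_le[OF this] show ?case by (simp add: dist_commute)
      qed
    qed (use elim in auto)
  qed
qed

end
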